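(* Let $A_n$ be invertible with $A_n^{-1}\in\mathscr{B}(H)$ for every $n\in\mathbb{Z}$. Assume that either (a) the first moment condition holds and $|z|=1$, or (b) the exponential moment condition holds with $\varepsilon>0$ and $e^{-\varepsilon/2}<|z|<e^{\varepsilon/2}$. Let $U^\pm$ be the Jost solutions and let $\{R(z),\widehat R(z)\}$ be any one of the pairs $$\{U^{\pm}(z),U^{\pm}(z^{-1})\},\qquad \{U^{\pm}(z),U^{\mp}(z^{-1})\},\qquad \{U^{\pm}(z),U^{\mp}(z)\}$$ (upper signs or lower signs throughout). If the inverse $W(R(\bar z)^*,\widehat R(z))^{-1}$ exists and belongs to $\mathscr{B}(H)$, then $\{R(z),\widehat R(z)\}$ is a fundamental system of formal solutions: for every formal operator solution $V(z)=\{V_n(z)\}_{n\in\mathbb{Z}}$ of $\tau V=\lambda V$ with $\lambda=z+z^{-1}$ there exists a unique pair of operators $P(z),Q(z)\in\mathscr{B}(H)$ (independent of $n$) such that for all $n\in\mathbb{Z}$ $$V_n(z)=R_n(z)P(z)+\widehat R_n(z)Q(z).$$ The same statement holds for formal vector solutions $v(z)$ of $\tau v=\lambda v$, with unique $P(z),Q(z)\in H$. Moreover, in the case $\{R(z),\widehat R(z)\}=\{U^{\pm}(z),U^{\mp}(z)\}$ and under the first moment condition, the statement holds for all $z$ with $0<|z|\le 1$ if either $\dim H<\infty$ or the operators $B_n$ and $A_n-I$ are compact for all $n\in\mathbb{Z}$.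
   Context: $H$ is a separable complex Hilbert space, $\mathscr{B}(H)$ the bounded operators on $H$ with operator norm, $I$ the identity. $\{A_n\}_{n\in\mathbb{Z}},\{B_n\}_{n\in\mathbb{Z}}\subset\mathscr{B}(H)$ are self-adjoint and $(\tau u)_n:=A_{n-1}u_{n-1}+B_nu_n+A_nu_{n+1}$. A formal operator (resp. vector) solution of $\tau u=\lambda u$ is a sequence in $\mathscr{B}(H)$ (resp. in $H$) satisfying $(\tau u)_n=\lambda u_n$ for all $n\in\mathbb{Z}$, with no summability required. First moment condition: $\sum_{n\in\mathbb{Z}}|n|(\|I-A_n\|+\|B_n\|)<\infty$. Exponential moment condition: for some $\varepsilon>0$, $\sum_{n\in\mathbb{Z}}e^{\varepsilon|n|}(\|I-A_n\|+\|B_n\|)<\infty$. Jost solutions: under the first moment condition with all $A_n^{-1}\in\mathscr{B}(H)$, for $0<|z|\le1$, $U^+(z)$ and $U^-(z)$ are the (unique) formal operator solutions of $\tau U=(z+z^{-1})U$ with $U_n^+(z)=z^n(I+o(1))$ as $n\to\infty$ and $U_n^-(z)=z^{-n}(I+o(1))$ as $n\to-\infty$ (in operator norm); each $U_n^\pm(z)$ is holomorphic in $0<|z|<1$ and continuous on $0<|z|\le 1$. Under the exponential moment condition each $U^\pm_n$ extends holomorphically to $0<|z|<e^{\varepsilon/2}$, and the extensions, still denoted $U^\pm(z)$, are formal operator solutions with the same asymptotics. Wronskian: for sequences $U,V$ in $\mathscr{B}(H)$, $W_n(U,V):=U_{n-1}A_{n-1}V_n-U_nA_{n-1}V_{n-1}$.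 If $U(\bar z)$ and $V(z)$ are formal operator solutions for parameters $\bar z+\bar z^{-1}$ and $z+z^{-1}$ respectively, then with $U(\bar z)^*:=\{U_n(\bar z)^*\}_n$ the operator $W_n(U(\bar z)^*,V(z))$ is independent of $n$ and is denoted $W(U(\bar z)^*,V(z))$. Here $R(\bar z)$ denotes the function $R$ evaluated at $\bar z$. *)

theory Defs
  imports "HOL-Analysis.Analysis"
begin

section \<open>Separable complex Hilbert spaces\<close>

class scaleC = scaleR +
  fixes scaleC :: "complex \<Rightarrow> 'a \<Rightarrow> 'a" (infixr \<open>*\<^sub>C\<close> 75)
  assumes scaleR_scaleC: "r *\<^sub>R x = complex_of_real r *\<^sub>C x"

class complex_normed_vector = real_normed_vector + scaleC +
  assumes scaleC_add_right: "a *\<^sub>C (x + y) = a *\<^sub>C x + a *\<^sub>C y"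
    and scaleC_add_left: "(a + b) *\<^sub>C x = a *\<^sub>C x + b *\<^sub>C x"
    and scaleC_scaleC: "a *\<^sub>C b *\<^sub>C x = (a * b) *\<^sub>C x"
    and scaleC_one: "1 *\<^sub>C x = x"
    and norm_scaleC: "norm (a *\<^sub>C x) = cmod a * norm x"

text \<open>The inner product is conjugate-linear in its first argument.\<close>

class complex_inner = complex_normed_vector +
  fixes cinner :: "'a \<Rightarrow> 'a \<Rightarrow> complex"
  assumes cinner_commute: "cinner x y = cnj (cinner y x)"
    and cinner_add_right: "cinner x (y + z) = cinner x y + cinner x z"
    and cinner_scaleC_right: "cinner x (a *\<^sub>C y) = a * cinner x y"
    and cinner_norm: "cinner x x = complex_of_real ((norm x)\<^sup>2)"

text \<open>For a metric space, separability is the second countability contained in \<open>polish_space\<close>.\<close>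

class separable_hilbert_space = complex_inner + polish_space

interpretation complex_vector: vector_space
  "scaleC :: complex \<Rightarrow> 'a \<Rightarrow> 'a::complex_normed_vector"
  by unfold_locales (simp_all add: scaleC_add_right scaleC_add_left scaleC_scaleC scaleC_one)

definition finite_dim_space :: "'a::complex_normed_vector itself \<Rightarrow> bool" where
  "finite_dim_space _ \<longleftrightarrow> (\<exists>S::'a set. finite S \<and> complex_vector.span S = UNIV)"


section \<open>The algebra of bounded operators\<close>

text \<open>The library's type of bounded linear maps is over the reals; \<open>'a bop\<close> consists of the
  complex-linear ones, with operator norm and composition as multiplication.\<close>

typedef (overloaded) 'a bop =
  "{T :: 'a::complex_normed_vector \<Rightarrow>\<^sub>L 'a. \<forall>c x. blinfun_apply T (c *\<^sub>C x) = c *\<^sub>C blinfun_apply T x}"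
  morphisms blinfun_of_bop Bop
  by (rule exI[of _ 0]) simp

setup_lifting type_definition_bop

lift_definition bop_apply :: "'a::complex_normed_vector bop \<Rightarrow> 'a \<Rightarrow> 'a" is blinfun_apply .

lemma bounded_linear_scaleC_right: "bounded_linear ((*\<^sub>C) (a::complex) :: 'a \<Rightarrow> 'a::complex_normed_vector)"
  by (rule bounded_linear_intro[where K = "cmod a"])
    (simp_all add: scaleC_add_right scaleR_scaleC scaleC_scaleC norm_scaleC mult.commute)

instantiation bop :: (complex_normed_vector) complex_normed_vector
begin

lift_definition zero_bop :: "'a bop" is 0 by simp
lift_definition plus_bop :: "'a bop \<Rightarrow> 'a bop \<Rightarrow> 'a bop" is "(+)"
  by (simp add: blinfun.add_left scaleC_add_right)
lift_definition minus_bop :: "'a bop \<Rightarrow> 'a bop \<Rightarrow> 'a bop" is "(-)"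
  by (simp add: blinfun.diff_left complex_vector.scale_right_diff_distrib)
lift_definition uminus_bop :: "'a bop \<Rightarrow> 'a bop" is uminus
  by (simp add: blinfun.minus_left)
lift_definition scaleR_bop :: "real \<Rightarrow> 'a bop \<Rightarrow> 'a bop" is scaleR
  by (simp add: blinfun.scaleR_left scaleR_scaleC scaleC_scaleC mult.commute)
lift_definition scaleC_bop :: "complex \<Rightarrow> 'a bop \<Rightarrow> 'a bop"
  is "\<lambda>a T. Blinfun ((*\<^sub>C) a) o\<^sub>L T"
  by (simp add: bounded_linear_Blinfun_apply bounded_linear_scaleC_right scaleC_scaleC mult.commute)
lift_definition norm_bop :: "'a bop \<Rightarrow> real" is norm .

definition dist_bop :: "'a bop \<Rightarrow> 'a bop \<Rightarrow> real" where
  "dist_bop S T = norm (S - T)"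
definition sgn_bop :: "'a bop \<Rightarrow> 'a bop" where
  "sgn_bop T = scaleR (inverse (norm T)) T"
definition uniformity_bop :: "('a bop \<times> 'a bop) filter" where
  [code del]: "uniformity_bop = (INF e\<in>{0<..}. principal {(S, T). dist S T < e})"
definition open_bop :: "'a bop set \<Rightarrow> bool" where
  [code del]: "open_bop X = (\<forall>S\<in>X. \<forall>\<^sub>F (S', T) in uniformity. S' = S \<longrightarrow> T \<in> X)"

instance
proof
  fix a b :: complex and r s :: real and R S T :: "'a bop" and X :: "'a bop set"
  note simps = blinfun.add_left blinfun.scaleR_left bounded_linear_Blinfun_apply
    bounded_linear_scaleC_right scaleC_add_right scaleC_add_left scaleC_scaleC scaleC_one
  show "R + S + T = R + (S + T)" by transfer (simp add: add.assoc)
  show "S + T = T + S" by transfer (simp add: add.commute)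
  show "0 + T = T" by transfer simp
  show "- T + T = 0" by transfer simp
  show "S - T = S + - T" by transfer simp
  show "r *\<^sub>R (S + T) = r *\<^sub>R S + r *\<^sub>R T" by transfer (simp add: scaleR_add_right)
  show "(r + s) *\<^sub>R T = r *\<^sub>R T + s *\<^sub>R T" by transfer (simp add: scaleR_add_left)
  show "r *\<^sub>R s *\<^sub>R T = (r * s) *\<^sub>R T" by transfer simp
  show "1 *\<^sub>R T = T" by transfer simp
  show "dist S T = norm (S - T)" by (rule dist_bop_def)
  show "sgn T = scaleR (inverse (norm T)) T" by (rule sgn_bop_def)
  show "uniformity = (INF e\<in>{0<..}. principal {(S, T). dist S (T::'a bop) < e})"
    by (rule uniformity_bop_def)
  show "open X = (\<forall>S\<in>X. \<forall>\<^sub>F (S', T) in uniformity. S' = S \<longrightarrow> T \<in> X)"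
    by (rule open_bop_def)
  show "(norm T = 0) = (T = 0)" by transfer simp
  show "norm (S + T) \<le> norm S + norm T" by transfer (rule norm_triangle_ineq)
  show "norm (r *\<^sub>R T) = \<bar>r\<bar> * norm T" by transfer simp
  show "r *\<^sub>R T = complex_of_real r *\<^sub>C T"
    by transfer (rule blinfun_eqI, simp add: simps scaleR_scaleC)
  show "a *\<^sub>C (S + T) = a *\<^sub>C S + a *\<^sub>C T"
    by transfer (rule blinfun_eqI, simp add: simps)
  show "(a + b) *\<^sub>C T = a *\<^sub>C T + b *\<^sub>C T"
    by transfer (rule blinfun_eqI, simp add: simps)
  show "a *\<^sub>C b *\<^sub>C T = (a * b) *\<^sub>C T"
    by transfer (rule blinfun_eqI, simp add: simps)
  show "1 *\<^sub>C T = T"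
    by transfer (rule blinfun_eqI, simp add: simps)
  show "norm (a *\<^sub>C T) = cmod a * norm T"
  proof transfer
    fix a :: complex and T :: "'a \<Rightarrow>\<^sub>L 'a"
    have "norm (Blinfun ((*\<^sub>C) a) o\<^sub>L T) \<le> cmod a * norm T" for a and T :: "'a \<Rightarrow>\<^sub>L 'a"
      by (rule norm_blinfun_bound)
        (simp_all add: bounded_linear_Blinfun_apply bounded_linear_scaleC_right norm_scaleC
          mult.assoc mult_left_mono norm_blinfun)
    note le = this
    show "norm (Blinfun ((*\<^sub>C) a) o\<^sub>L T) = cmod a * norm T"
    proof (cases "a = 0")
      case True
      then show ?thesis using le[of a T] by simp
    next
      case False
      have "Blinfun ((*\<^sub>C) (inverse a)) o\<^sub>L (Blinfun ((*\<^sub>C) a) o\<^sub>L T) = T"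
        using False by (intro blinfun_eqI)
          (simp add: bounded_linear_Blinfun_apply bounded_linear_scaleC_right scaleC_scaleC scaleC_one)
      then have "norm T \<le> cmod (inverse a) * norm (Blinfun ((*\<^sub>C) a) o\<^sub>L T)"
        using le[of "inverse a" "Blinfun ((*\<^sub>C) a) o\<^sub>L T"] by simp
      then have "cmod a * norm T \<le> norm (Blinfun ((*\<^sub>C) a) o\<^sub>L T)"
        using False by (simp add: norm_divide norm_inverse field_simps)
      with le[of a T] show ?thesis by simp
    qed
  qed
qed

end
instantiation bop :: (complex_normed_vector) "{real_normed_algebra, monoid_mult}"
begin
lift_definition one_bop :: "'a bop" is id_blinfun by simp
lift_definition times_bop :: "'a bop \<Rightarrow> 'a bop \<Rightarrow> 'a bop" is "(o\<^sub>L)" by simp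
instance
proof
  fix r :: real and R S T :: "'a bop"
  show "R * S * T = R * (S * T)" by transfer (rule blinfun_eqI, simp)
  show "1 * T = T" "T * 1 = T" by (transfer, rule blinfun_eqI, simp)+
  show "(R + S) * T = R * T + S * T" by transfer (rule bounded_bilinear.add_left[OF bounded_bilinear_blinfun_compose])
  show "R * (S + T) = R * S + R * T" by transfer (rule bounded_bilinear.add_right[OF bounded_bilinear_blinfun_compose])
  show "r *\<^sub>R S * T = r *\<^sub>R (S * T)" by transfer (rule bounded_bilinear.scaleR_left[OF bounded_bilinear_blinfun_compose])
  show "S * r *\<^sub>R T = r *\<^sub>R (S * T)" by transfer (rule bounded_bilinear.scaleR_right[OF bounded_bilinear_blinfun_compose])
  show "norm (S * T) \<le> norm S * norm T" by transfer (rule norm_blinfun_compose)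
qed

end

definition invertible_bop :: "'a::complex_normed_vector bop \<Rightarrow> bool" where
  "invertible_bop T \<longleftrightarrow> (\<exists>S. S * T = 1 \<and> T * S = 1)"

definition compact_bop :: "'a::complex_normed_vector bop \<Rightarrow> bool" where
  "compact_bop T \<longleftrightarrow> (\<forall>X. bounded X \<longrightarrow> compact (closure (bop_apply T ` X)))"

definition adj :: "'h::separable_hilbert_space bop \<Rightarrow> 'h bop" where
  "adj T = (THE S. \<forall>x y. cinner (bop_apply T x) y = cinner x (bop_apply S y))"

definition selfadjoint :: "'h::separable_hilbert_space bop \<Rightarrow> bool" where
  "selfadjoint T \<longleftrightarrow> adj T = T"

text \<open>Complex differentiability with respect to the norm; the library's \<open>holomorphic_on\<close> only
  covers scalar functions.\<close>

definition norm_holomorphic_on :: "(complex \<Rightarrow> 'b::complex_normed_vector) \<Rightarrow> complex set \<Rightarrow> bool" where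
  "norm_holomorphic_on f X \<longleftrightarrow>
    (\<forall>z\<in>X. \<exists>D. ((\<lambda>w. inverse (w - z) *\<^sub>C (f w - f z)) \<longlongrightarrow> D) (at z within X))"


section \<open>Jacobi operators with operator-valued coefficients\<close>

definition op_solution ::
  "(int \<Rightarrow> 'h::separable_hilbert_space bop) \<Rightarrow> (int \<Rightarrow> 'h bop) \<Rightarrow> complex \<Rightarrow> (int \<Rightarrow> 'h bop) \<Rightarrow> bool" where
  "op_solution A B lam U \<longleftrightarrow>
    (\<forall>n. A (n - 1) * U (n - 1) + B n * U n + A n * U (n + 1) = lam *\<^sub>C U n)"

definition vec_solution ::
  "(int \<Rightarrow> 'h::separable_hilbert_space bop) \<Rightarrow> (int \<Rightarrow> 'h bop) \<Rightarrow> complex \<Rightarrow> (int \<Rightarrow> 'h) \<Rightarrow> bool" where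
  "vec_solution A B lam u \<longleftrightarrow>
    (\<forall>n. bop_apply (A (n - 1)) (u (n - 1)) + bop_apply (B n) (u n) + bop_apply (A n) (u (n + 1))
      = lam *\<^sub>C u n)"

definition first_moment ::
  "(int \<Rightarrow> 'h::separable_hilbert_space bop) \<Rightarrow> (int \<Rightarrow> 'h bop) \<Rightarrow> bool" where
  "first_moment A B \<longleftrightarrow>
    (\<lambda>n. real_of_int \<bar>n\<bar> * (norm (1 - A n) + norm (B n))) summable_on UNIV"

definition exp_moment ::
  "real \<Rightarrow> (int \<Rightarrow> 'h::separable_hilbert_space bop) \<Rightarrow> (int \<Rightarrow> 'h bop) \<Rightarrow> bool" where
  "exp_moment \<epsilon> A B \<longleftrightarrow>
    (\<lambda>n. exp (\<epsilon> * real_of_int \<bar>n\<bar>) * (norm (1 - A n) + norm (B n))) summable_on UNIV"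

text \<open>The Jost solutions are treated as functions of \<open>z\<close> whose values outside the stated ranges of
  \<open>z\<close> are arbitrary.  On \<open>0 < |z| \<le> 1\<close> they are characterised by their asymptotics.\<close>

definition jost_plus ::
  "(int \<Rightarrow> 'h::separable_hilbert_space bop) \<Rightarrow> (int \<Rightarrow> 'h bop) \<Rightarrow> (complex \<Rightarrow> int \<Rightarrow> 'h bop) \<Rightarrow> bool" where
  "jost_plus A B U \<longleftrightarrow> (\<forall>z. 0 < cmod z \<and> cmod z \<le> 1 \<longrightarrow>
    op_solution A B (z + inverse z) (U z) \<and>
    (\<exists>E. (E \<longlongrightarrow> 0) at_top \<and> (\<forall>n. U z n = (z powi n) *\<^sub>C (1 + E n))))"

definition jost_minus ::
  "(int \<Rightarrow> 'h::separable_hilbert_space bop) \<Rightarrow> (int \<Rightarrow> 'h bop) \<Rightarrow> (complex \<Rightarrow> int \<Rightarrow> 'h bop) \<Rightarrow> bool" where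
  "jost_minus A B U \<longleftrightarrow> (\<forall>z. 0 < cmod z \<and> cmod z \<le> 1 \<longrightarrow>
    op_solution A B (z + inverse z) (U z) \<and>
    (\<exists>E. (E \<longlongrightarrow> 0) at_bot \<and> (\<forall>n. U z n = (z powi (- n)) *\<^sub>C (1 + E n))))"

text \<open>The continuation to a larger punctured disc is determined by holomorphy alone: for \<open>|z| > 1\<close>
  the asymptotics would not single out a solution.\<close>

definition holomorphic_extension :: "real \<Rightarrow> (complex \<Rightarrow> int \<Rightarrow> 'b::complex_normed_vector) \<Rightarrow> bool" where
  "holomorphic_extension \<epsilon> U \<longleftrightarrow>
    (\<forall>n. norm_holomorphic_on (\<lambda>z. U z n) {z. 0 < cmod z \<and> cmod z < exp (\<epsilon> / 2)})"

definition wronskian_at ::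
  "(int \<Rightarrow> 'h::separable_hilbert_space bop) \<Rightarrow> (int \<Rightarrow> 'h bop) \<Rightarrow> (int \<Rightarrow> 'h bop) \<Rightarrow> int \<Rightarrow> 'h bop" where
  "wronskian_at A U V n = U (n - 1) * A (n - 1) * V n - U n * A (n - 1) * V (n - 1)"

text \<open>Meaningful only where \<open>wronskian_at A U V n\<close> is independent of \<open>n\<close>.\<close>

definition wronskian ::
  "(int \<Rightarrow> 'h::separable_hilbert_space bop) \<Rightarrow> (int \<Rightarrow> 'h bop) \<Rightarrow> (int \<Rightarrow> 'h bop) \<Rightarrow> 'h bop" where
  "wronskian A U V = (THE W. \<forall>n. wronskian_at A U V n = W)"

definition fundamental_system ::
  "(int \<Rightarrow> 'h::separable_hilbert_space bop) \<Rightarrow> (int \<Rightarrow> 'h bop) \<Rightarrow> complex \<Rightarrow>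
    (int \<Rightarrow> 'h bop) \<Rightarrow> (int \<Rightarrow> 'h bop) \<Rightarrow> bool" where
  "fundamental_system A B lam R S \<longleftrightarrow>
    op_solution A B lam R \<and> op_solution A B lam S \<and>
    (\<forall>V. op_solution A B lam V \<longrightarrow>
      (\<exists>!(P, Q). \<forall>n. V n = R n * P + S n * Q)) \<and>
    (\<forall>v. vec_solution A B lam v \<longrightarrow>
      (\<exists>!(p, q). \<forall>n. v n = bop_apply (R n) p + bop_apply (S n) q))"

end

theory Submission
  imports Defs "HOL-Complex_Analysis.Conformal_Mappings"
begin

text \<open>
  Let \<open>L\<^sub>n = R\<^sub>n(cnj z)\<^sup>*\<close>. Pairing with \<open>L\<close> reads off \<open>Q = W(L, S)\<^sup>-\<^sup>1 W(L, V)\<close>, because \<open>W(L, R) = 0\<close>,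
  and it remains to see that a solution \<open>V\<close> with \<open>W(L, V) = 0\<close> has the form \<open>R P\<close> with a unique \<open>P\<close>.
  For \<open>\<bar>z\<bar> \<le> 1\<close> this holds because \<open>R\<^sub>m\<close> and \<open>L\<^sub>m\<close> are invertible for some \<open>m\<close> far out: subtracting
  \<open>R R\<^sub>m\<^sup>-\<^sup>1 V\<^sub>m\<close> makes \<open>V\<close> vanish at \<open>m\<close>, and the vanishing Wronskian then makes it vanish at \<open>m + 1\<close>.
  For \<open>\<bar>z\<bar> > 1\<close> the identities \<open>W(U(cnj z)\<^sup>*, U(z)) = 0\<close> and
  \<open>W(U(cnj z)\<^sup>*, U(1/z)) = \<plusminus>(1/z - z) I\<close> extend from the unit circle by analytic continuation; hence
  \<open>U(1/z), U(z)\<close> is a fundamental system, and the claim for \<open>R = U(z)\<close> follows from the one for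
  \<open>U(1/z)\<close>.
\<close>

section \<open>Riesz representation and adjoints\<close>

lemma cinner_add_left: "cinner (x + y) z = cinner x z + cinner y z"
  by (metis cinner_add_right cinner_commute complex_cnj_add)

lemma cinner_scaleC_left: "cinner (a *\<^sub>C x) y = cnj a * cinner x y"
  by (metis cinner_commute cinner_scaleC_right complex_cnj_mult)

lemma cinner_zero_right [simp]: "cinner x 0 = 0"
  using cinner_add_right[of x 0 0] by simp

lemma cinner_zero_left [simp]: "cinner 0 x = 0"
  using cinner_add_left[of 0 0 x] by simp

lemma cinner_diff_right: "cinner x (y - z) = cinner x y - cinner x z"
  using cinner_add_right[of x "y - z" z] by simp

lemma cinner_right_eqI:
  assumes "\<And>x. cinner x y = cinner x z"
  shows "y = z"
  using assms[of "y - z"] cinner_norm[of "y - z"] by (simp add: cinner_diff_right)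

text \<open>The common source of the orthogonality criterion, the Cauchy-Schwarz inequality and the
  parallelogram law, each obtained by a choice of \<open>t\<close>.\<close>

lemma norm_add_scaleC_square:
  "(norm (x + t *\<^sub>C y))\<^sup>2 = (norm x)\<^sup>2 + 2 * Re (t * cinner x y) + (cmod t * norm y)\<^sup>2"
proof -
  have "complex_of_real ((norm (x + t *\<^sub>C y))\<^sup>2)
      = cinner x x + (t * cinner x y + cnj (t * cinner x y)) + (t * cnj t) * cinner y y"
    unfolding cinner_norm[symmetric] using cinner_commute[of y x]
    by (simp add: cinner_add_left cinner_add_right
      cinner_scaleC_left cinner_scaleC_right algebra_simps)
  also have "\<dots> = complex_of_real
      ((norm x)\<^sup>2 + 2 * Re (t * cinner x y) + (cmod t * norm y)\<^sup>2)"
    by (simp only: complex_add_cnj cinner_norm complex_norm_square[symmetric])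
      (simp add: power_mult_distrib)
  finally show ?thesis
    by (simp only: of_real_eq_iff)
qed

text \<open>First variation: moving from \<open>w\<close> along \<open>u\<close> by a small negative
  multiple of the conjugate of \<open>cinner w u\<close> lowers the squared norm to first order,
  unless that inner product vanishes.\<close>

lemma norm_minimal_imp_orthogonal:
  assumes min: "\<And>t. norm w \<le> norm (w + t *\<^sub>C u)"
  shows "cinner w u = 0"
proof (rule ccontr)
  define c where "c = cinner w u"
  \<comment> \<open>The summand 1 covers \<open>u = 0\<close> and keeps \<open>s\<close> so small
    that the first-order decrease outweighs the quadratic term.\<close>
  define s where "s = 1 / ((norm u)\<^sup>2 + 1)"
  assume "cinner w u \<noteq> 0"
  then have "cmod c > 0" by (simp add: c_def)
  have s: "s > 0" "s * (norm u)\<^sup>2 < 1"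
    unfolding s_def by (auto simp: field_simps add_pos_nonneg)
  define t where "t = - (complex_of_real s * cnj c)"
  have "cnj c * c = complex_of_real ((cmod c)\<^sup>2)"
    by (metis complex_norm_square mult.commute)
  then have "t * c = complex_of_real (- (s * (cmod c)\<^sup>2))"
    by (simp add: t_def mult.assoc)
  then have "Re (t * c) = - (s * (cmod c)\<^sup>2)"
    by simp
  moreover have "cmod t = s * cmod c"
    using s by (simp add: t_def norm_mult)
  ultimately have "(norm (w + t *\<^sub>C u))\<^sup>2
      = (norm w)\<^sup>2 + s * (cmod c)\<^sup>2 * (s * (norm u)\<^sup>2 - 2)"
    unfolding norm_add_scaleC_square c_def[symmetric]
    by (simp add: power2_eq_square algebra_simps)
  moreover have "s * (cmod c)\<^sup>2 * (s * (norm u)\<^sup>2 - 2) < 0"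
    using s \<open>cmod c > 0\<close> by (intro mult_pos_neg) auto
  ultimately have "(norm (w + t *\<^sub>C u))\<^sup>2 < (norm w)\<^sup>2"
    by simp
  then show False
    using power_mono[OF min[of t], of 2] by (simp add: not_le[symmetric])
qed

lemma cmod_cinner_le: "cmod (cinner x y) \<le> norm x * norm y"
proof (cases "y = 0")
  case False
  define c where "c = cinner x y"
  \<comment> \<open>This \<open>t\<close> minimises the norm of \<open>x + t *\<^sub>C y\<close>;
    Cauchy-Schwarz expresses that the square of this minimum is nonnegative.\<close>
  define t where "t = - (cnj c / complex_of_real ((norm y)\<^sup>2))"
  have ny: "norm y > 0" using False by simp
  have "cnj c * c = complex_of_real ((cmod c)\<^sup>2)"
    by (metis complex_norm_square mult.commute)
  then have "t * c = complex_of_real (- ((cmod c)\<^sup>2 / (norm y)\<^sup>2))"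
    by (simp add: t_def)
  then have "Re (t * c) = - ((cmod c)\<^sup>2 / (norm y)\<^sup>2)"
    by simp
  moreover have "cmod t = cmod c / (norm y)\<^sup>2"
    by (simp add: t_def norm_divide norm_power)
  then have "(cmod t * norm y)\<^sup>2 = (cmod c)\<^sup>2 / (norm y)\<^sup>2"
    using ny by (simp add: field_simps power2_eq_square)
  ultimately have "(norm (x + t *\<^sub>C y))\<^sup>2 = (norm x)\<^sup>2 - (cmod c)\<^sup>2 / (norm y)\<^sup>2"
    unfolding norm_add_scaleC_square c_def[symmetric] by simp
  then have "(cmod c)\<^sup>2 / (norm y)\<^sup>2 \<le> (norm x)\<^sup>2"
    by (smt (verit) zero_le_power2)
  then have "(cmod c)\<^sup>2 \<le> (norm x * norm y)\<^sup>2"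
    using ny by (simp add: field_simps power_mult_distrib)
  then show ?thesis
    unfolding c_def by (rule power2_le_imp_le) simp
qed simp

lemma parallelogram_law:
  fixes x y :: "'a::complex_inner"
  shows "(norm (x - y))\<^sup>2 = 2 * (norm x)\<^sup>2 + 2 * (norm y)\<^sup>2 - (norm (x + y))\<^sup>2"
  using norm_add_scaleC_square[of x 1 y] norm_add_scaleC_square[of x "-1" y]
  by (simp add: scaleC_one)

text \<open>The hyperplane on which \<open>f\<close> is 1 contains a point \<open>w\<close> of least
  norm, and \<open>w\<close> is orthogonal to the kernel of \<open>f\<close>; rescaling
  \<open>w\<close> gives the representing vector.\<close>

lemma riesz_representation:
  fixes f :: "'h::separable_hilbert_space \<Rightarrow> complex"
  assumes add: "\<And>x y. f (x + y) = f x + f y"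
    and scale: "\<And>c x. f (c *\<^sub>C x) = c * f x"
    and bound: "\<And>x. cmod (f x) \<le> K * norm x"
  shows "\<exists>y. \<forall>x. f x = cinner y x"
proof (cases "\<forall>x. f x = 0")
  case True
  then show ?thesis by (intro exI[of _ 0]) simp
next
  case False
  then obtain x0 where x0: "f x0 \<noteq> 0" by blast
  define M where "M = {x. f x = 1}"
  have "inverse (f x0) *\<^sub>C x0 \<in> M"
    using x0 by (simp add: M_def scale)
  then have Mne: "norm ` M \<noteq> {}" by blast
  have bdd: "bdd_below (norm ` M)" by (rule bdd_belowI2[of _ 0]) simp
  define d where "d = Inf (norm ` M)"
  have d_le: "d \<le> norm x" if "x \<in> M" for x
    unfolding d_def using that bdd by (intro cInf_lower) auto
  have d0: "d \<ge> 0"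
    unfolding d_def using Mne by (intro cInf_greatest) auto
  have "\<exists>x\<in>M. norm x < d + 1 / real (Suc n)" for n
  proof -
    have "Inf (norm ` M) < d + 1 / real (Suc n)" by (simp add: d_def)
    from cInf_lessD[OF Mne this] show ?thesis by blast
  qed
  then obtain X where X: "\<And>n. X n \<in> M" "\<And>n. norm (X n) < d + 1 / real (Suc n)"
    by metis
  \<comment> \<open>A minimising sequence is Cauchy: the midpoint of two of its points stays in
    \<open>M\<close>, hence has norm at least \<open>d\<close>, and the parallelogram law then
    bounds their distance.\<close>
  have dist_le: "(norm (X m - X n))\<^sup>2 \<le> (8 * d + 4) / real (Suc N)"
    if "N \<le> m" "N \<le> n" for m n N
  proof -
    define q where "q = 1 / real (Suc N)"
    have q: "0 \<le> q" "q \<le> 1" by (simp_all add: q_def)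
    have *: "(norm (X k))\<^sup>2 \<le> d\<^sup>2 + (2 * d + 1) * q" if "N \<le> k" for k
    proof -
      have "1 / real (Suc k) \<le> q"
        unfolding q_def using that by (intro divide_left_mono) auto
      then have "norm (X k) \<le> d + q"
        using X(2)[of k] by linarith
      then have "(norm (X k))\<^sup>2 \<le> (d + q)\<^sup>2"
        by (rule power_mono) simp
      also have "\<dots> = d\<^sup>2 + (2 * d + q) * q"
        by (simp add: power2_eq_square algebra_simps)
      also have "\<dots> \<le> d\<^sup>2 + (2 * d + 1) * q"
        using q by (intro add_left_mono mult_right_mono) auto
      finally show ?thesis .
    qed
    have "(1 / 2 :: complex) *\<^sub>C (X m + X n) \<in> M"
      using X(1)[of m] X(1)[of n] by (simp add: M_def scale add)
    from d_le[OF this] have "2 * d \<le> norm (X m + X n)"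
      by (simp add: norm_scaleC norm_divide)
    then have "4 * d\<^sup>2 \<le> (norm (X m + X n))\<^sup>2"
      using power_mono[of "2 * d" _ 2] d0 by (simp add: power_mult_distrib)
    then have "(norm (X m - X n))\<^sup>2 \<le> 4 * ((2 * d + 1) * q)"
      using parallelogram_law[of "X m" "X n"] *[OF that(1)] *[OF that(2)]
      by linarith
    also have "\<dots> = (8 * d + 4) / real (Suc N)"
      by (simp add: q_def)
    finally show ?thesis .
  qed
  have "Cauchy X"
  proof (rule metric_CauchyI)
    fix e :: real assume e: "e > 0"
    obtain N where "(8 * d + 4) / e\<^sup>2 < real N"
      using reals_Archimedean2 by blast
    then have N: "(8 * d + 4) / e\<^sup>2 < real (Suc N)" by simp
    show "\<exists>N. \<forall>m\<ge>N. \<forall>n\<ge>N. dist (X m) (X n) < e"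
    proof (intro exI allI impI)
      fix m n assume "N \<le> m" "N \<le> n"
      from dist_le[OF this] have "(norm (X m - X n))\<^sup>2 \<le> (8 * d + 4) / real (Suc N)" .
      also have "\<dots> < e\<^sup>2"
        using N e by (simp add: field_simps)
      finally show "dist (X m) (X n) < e"
        using e by (simp add: dist_norm power2_less_imp_less)
    qed
  qed
  then obtain w where w: "X \<longlonglongrightarrow> w"
    using Cauchy_convergent convergent_def by blast
  have f_diff: "f (x - y) = f x - f y" for x y
    using add[of "x - y" y] by simp
  have "(\<lambda>n. f (X n) - f w) \<longlonglongrightarrow> 0"
  proof (rule Lim_null_comparison)
    show "\<forall>\<^sub>F n in sequentially. norm (f (X n) - f w) \<le> K * norm (X n - w)"
      using bound by (simp add: f_diff[symmetric])
    show "(\<lambda>n. K * norm (X n - w)) \<longlonglongrightarrow> 0"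
      by (rule tendsto_mult_right_zero) (intro tendsto_norm_zero LIM_zero w)
  qed
  then have "(\<lambda>n. 1 - f w) \<longlonglongrightarrow> 0"
    using X(1) by (simp add: M_def)
  then have fw: "f w = 1"
    by (simp add: LIMSEQ_const_iff)
  have "norm w \<le> d"
  proof (rule LIMSEQ_le)
    show "(\<lambda>n. norm (X n)) \<longlonglongrightarrow> norm w" using w by (rule tendsto_norm)
    show "(\<lambda>n. d + 1 / real (Suc n)) \<longlonglongrightarrow> d"
      using tendsto_add[OF tendsto_const[of d] LIMSEQ_Suc[OF lim_1_over_n]] by simp
    show "\<exists>N. \<forall>n\<ge>N. norm (X n) \<le> d + 1 / real (Suc n)"
      using X(2) less_imp_le by blast
  qed
  have orth: "cinner w u = 0" if "f u = 0" for u
  proof (rule norm_minimal_imp_orthogonal)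
    fix t
    have "w + t *\<^sub>C u \<in> M" using fw that by (simp add: M_def add scale)
    then show "norm w \<le> norm (w + t *\<^sub>C u)"
      by (rule order_trans[OF \<open>norm w \<le> d\<close> d_le])
  qed
  have "f 0 = 0" using add[of 0 0] by simp
  then have w0: "w \<noteq> 0" using fw by auto
  \<comment> \<open>The vector \<open>x - f x *\<^sub>C w\<close> lies in the kernel of
    \<open>f\<close> because \<open>f w = 1\<close>.\<close>
  have "cinner w x = f x * complex_of_real ((norm w)\<^sup>2)" for x
    using orth[of "x - f x *\<^sub>C w"]
    by (simp add: f_diff scale fw cinner_diff_right cinner_scaleC_right cinner_norm)
  then have "f x = cinner (complex_of_real (1 / (norm w)\<^sup>2) *\<^sub>C w) x" for x
    using w0 by (simp add: cinner_scaleC_left)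
  then show ?thesis by blast
qed

section \<open>Bounded complex-linear operators and their adjoints\<close>

lemma bop_eqI: "(\<And>x. bop_apply S x = bop_apply T x) \<Longrightarrow> S = T"
  by transfer (rule blinfun_eqI)

lemma bop_apply_simps [simp]:
  "bop_apply (S + T) x = bop_apply S x + bop_apply T x"
  "bop_apply (S - T) x = bop_apply S x - bop_apply T x"
  "bop_apply (S * T) x = bop_apply S (bop_apply T x)"
  "bop_apply (c *\<^sub>C T) x = c *\<^sub>C bop_apply T x"
  "bop_apply 0 x = 0"
  "bop_apply 1 x = x"
  by (transfer, simp add: blinfun.add_left blinfun.diff_left bounded_linear_Blinfun_apply
    bounded_linear_scaleC_right)+

lemma bop_apply_linear [simp]:
  "bop_apply T (x + y) = bop_apply T x + bop_apply T y"
  "bop_apply T (x - y) = bop_apply T x - bop_apply T y"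
  "bop_apply T (c *\<^sub>C x) = c *\<^sub>C bop_apply T x"
  "bop_apply T 0 = 0"
  by (transfer, simp add: blinfun.add_right blinfun.diff_right)+

lemma norm_bop_apply: "norm (bop_apply T x) \<le> norm T * norm x"
  by transfer (rule norm_blinfun)

lemma cmod_cinner_bop_le: "cmod (cinner (bop_apply T x) y) \<le> norm T * norm x * norm y"
  by (rule order_trans[OF cmod_cinner_le mult_right_mono[OF norm_bop_apply]]) simp

lemma norm_bop_bound: "0 \<le> K \<Longrightarrow> (\<And>x. norm (bop_apply T x) \<le> K * norm x) \<Longrightarrow> norm T \<le> K"
  by transfer (rule norm_blinfun_bound)

lemma bop_scaleC_mult [simp]: "(c *\<^sub>C S) * T = c *\<^sub>C (S * T)"
  for T :: "'a::complex_normed_vector bop"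
  by (rule bop_eqI) simp

lemma bop_mult_scaleC [simp]: "S * (c *\<^sub>C T) = c *\<^sub>C (S * T)"
  for T :: "'a::complex_normed_vector bop"
  by (rule bop_eqI) simp

text \<open>Adjoints, inverses of small perturbations of 1 and rank-one operators are all built
  through this lemma from their pointwise values.\<close>

lemma ex_bop:
  fixes f :: "'a::complex_normed_vector \<Rightarrow> 'a"
  assumes "\<And>x y. f (x + y) = f x + f y" "\<And>c x. f (c *\<^sub>C x) = c *\<^sub>C f x"
    and "\<And>x. norm (f x) \<le> K * norm x"
  shows "\<exists>T. \<forall>x. bop_apply T x = f x"
proof -
  have "bounded_linear f"
    by (rule bounded_linear_intro[where K = K])
      (use assms in \<open>simp_all add: scaleR_scaleC mult.commute\<close>)
  then have "bop_apply (Bop (Blinfun f)) x = f x" for x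
    using assms(2)
    by (simp add: bop_apply.rep_eq Bop_inverse bounded_linear_Blinfun_apply)
  then show ?thesis by blast
qed

text \<open>Riesz representation applies to the functional \<open>cinner y (bop_apply T x)\<close>
  of \<open>x\<close>; uniqueness of the representing vector makes it depend linearly on
  \<open>y\<close>.\<close>

lemma ex_adjoint:
  fixes T :: "'h::separable_hilbert_space bop"
  shows "\<exists>S. \<forall>x y. cinner (bop_apply T x) y = cinner x (bop_apply S y)"
proof -
  have "\<exists>z. \<forall>x. cinner y (bop_apply T x) = cinner z x" for y
  proof (rule riesz_representation)
    fix x
    have "cmod (cinner y (bop_apply T x)) \<le> norm y * (norm T * norm x)"
      by (rule order_trans[OF cmod_cinner_le mult_left_mono[OF norm_bop_apply]]) simp
    then show "cmod (cinner y (bop_apply T x)) \<le> (norm y * norm T) * norm x"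
      by (simp add: mult.assoc)
  qed (simp_all add: cinner_add_right cinner_scaleC_right)
  then obtain g where g: "\<And>x y. cinner y (bop_apply T x) = cinner (g y) x"
    by metis
  then have g': "cinner (bop_apply T x) y = cinner x (g y)" for x y
    by (metis cinner_commute)
  have "\<exists>S. \<forall>y. bop_apply S y = g y"
  proof (rule ex_bop)
    show "g (x + y) = g x + g y" for x y
      by (rule cinner_right_eqI) (simp add: cinner_add_right g'[symmetric])
    show "g (c *\<^sub>C x) = c *\<^sub>C g x" for c x
      by (rule cinner_right_eqI) (simp add: cinner_scaleC_right g'[symmetric])
    show "norm (g y) \<le> norm T * norm y" for y
    proof -
      \<comment> \<open>The adjoint relation is evaluated at \<open>x = g y\<close>; after
        Cauchy-Schwarz one factor \<open>norm (g y)\<close> cancels.\<close>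
      have "norm (g y) * norm (g y) = cmod (cinner (bop_apply T (g y)) y)"
        by (simp add: g' cinner_norm power2_eq_square norm_mult)
      also have "\<dots> \<le> norm (g y) * (norm T * norm y)"
        using cmod_cinner_bop_le[of T "g y" y] by (simp add: mult_ac)
      finally show ?thesis
        by (cases "g y = 0") auto
    qed
  qed
  then show ?thesis using g' by metis
qed

text \<open>This makes the definite description in \<open>adj\<close> legitimate: a second candidate
  would have the same inner products and hence the same values.\<close>

lemma cinner_adj: "cinner (bop_apply T x) y = cinner x (bop_apply (adj T) y)"
proof -
  have "\<exists>!S. \<forall>x y. cinner (bop_apply T x) y = cinner x (bop_apply S y)"
    by (rule ex_ex1I[OF ex_adjoint]) (metis bop_eqI cinner_right_eqI)
  from theI'[OF this] show ?thesis unfolding adj_def by blast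
qed

lemma adj_eqI:
  assumes "\<And>x y. cinner (bop_apply T x) y = cinner x (bop_apply S y)"
  shows "adj T = S"
  by (rule bop_eqI, rule cinner_right_eqI) (metis assms cinner_adj)

lemma adj_add: "adj (S + T) = adj S + adj T"
  by (rule adj_eqI) (simp add: cinner_add_left cinner_add_right cinner_adj)

lemma adj_scaleC: "adj (c *\<^sub>C T) = cnj c *\<^sub>C adj T"
  by (rule adj_eqI) (simp add: cinner_scaleC_left cinner_scaleC_right cinner_adj)

lemma adj_mult: "adj (S * T) = adj T * adj S"
  by (rule adj_eqI) (simp add: cinner_adj)

lemma adj_one [simp]: "adj 1 = 1"
  by (rule adj_eqI) simp

lemma norm_adj_le: "norm (adj T) \<le> norm T"
proof (rule norm_bop_bound)
  fix y
  let ?z = "bop_apply (adj T) y"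
  have "norm ?z * norm ?z = cmod (cinner (bop_apply T ?z) y)"
    by (simp add: cinner_adj cinner_norm power2_eq_square norm_mult)
  also have "\<dots> \<le> norm ?z * (norm T * norm y)"
    using cmod_cinner_bop_le[of T ?z y] by (simp add: mult_ac)
  finally show "norm ?z \<le> norm T * norm y"
    by (cases "?z = 0") auto
qed simp

text \<open>The adjoint is conjugate-linear over the complex numbers but linear over the reals,
  which is enough for limits and real Frechet derivatives.\<close>

lemma bounded_linear_adj: "bounded_linear (adj :: 'h::separable_hilbert_space bop \<Rightarrow> 'h bop)"
  by (rule bounded_linear_intro[where K = 1])
    (simp_all add: adj_add adj_scaleC scaleR_scaleC norm_adj_le)

section \<open>Invertibility of operators\<close>

lemma invertible_bop_scaleC:
  assumes "invertible_bop T" "c \<noteq> 0"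
  shows "invertible_bop (c *\<^sub>C T)"
proof -
  from assms(1) obtain S where "S * T = 1" "T * S = 1"
    unfolding invertible_bop_def by blast
  then show ?thesis
    unfolding invertible_bop_def using assms(2)
    by (intro exI[of _ "inverse c *\<^sub>C S"]) (simp add: scaleC_scaleC scaleC_one)
qed

lemma invertible_bop_one [simp]: "invertible_bop 1"
  unfolding invertible_bop_def by auto

lemma invertible_bop_mult_cancel:
  "invertible_bop T \<Longrightarrow> T * X = T * Y \<longleftrightarrow> X = Y"
  unfolding invertible_bop_def by (metis mult.assoc mult_1_left)

text \<open>Solving \<open>x + E x = y\<close> by Banach's fixed point theorem avoids completeness of \<open>'h bop\<close>.\<close>

lemma invertible_bop_one_plus:
  fixes E :: "'h::separable_hilbert_space bop"
  assumes E: "norm E < 1"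
  shows "invertible_bop (1 + E)"
proof -
  \<comment> \<open>This lower bound yields both the injectivity of \<open>1 + E\<close> and the
    norm bound for its inverse.\<close>
  have inj: "(1 - norm E) * norm x \<le> norm (bop_apply (1 + E) x)" for x
    using norm_bop_apply[of E x] norm_diff_ineq[of x "bop_apply E x"]
    by (simp add: algebra_simps)
  have "\<exists>!x. y - bop_apply E x = x" for y
  proof (rule banach_fix_type[OF _ E])
    show "\<forall>x z. dist (y - bop_apply E x) (y - bop_apply E z) \<le> norm E * dist x z"
      using norm_bop_apply[of E]
      by (simp add: dist_norm flip: bop_apply_linear) (metis norm_minus_commute)
  qed simp
  then obtain g where "\<And>y. y - bop_apply E (g y) = g y"
    by metis
  then have g: "bop_apply (1 + E) (g y) = y" for y
    by (simp add: algebra_simps eq_diff_eq)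
  have uniq: "x = z" if "bop_apply (1 + E) x = bop_apply (1 + E) z" for x z
  proof -
    have "bop_apply (1 + E) (x - z) = 0" using that by (simp only: bop_apply_linear) simp
    then have "(1 - norm E) * norm (x - z) \<le> 0" using inj[of "x - z"] by simp
    then show ?thesis using E by (simp add: mult_le_0_iff)
  qed
  \<comment> \<open>Injectivity reduces the linearity of \<open>g\<close> to identities that hold
    after applying \<open>1 + E\<close>.\<close>
  have "\<exists>S. \<forall>y. bop_apply S y = g y"
  proof (rule ex_bop)
    show "g (x + y) = g x + g y" for x y
      by (rule uniq) (simp only: g bop_apply_linear)
    show "g (c *\<^sub>C x) = c *\<^sub>C g x" for c x
      by (rule uniq) (simp only: g bop_apply_linear)
    show "norm (g y) \<le> 1 / (1 - norm E) * norm y" for y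
      using inj[of "g y"] E unfolding g by (simp add: field_simps)
  qed
  then obtain S where S: "\<And>y. bop_apply S y = g y" by blast
  have "(1 + E) * S = 1"
    by (rule bop_eqI) (simp only: bop_apply_simps(3,6) S g)
  moreover have "S * (1 + E) = 1"
    by (rule bop_eqI, rule uniq) (simp only: bop_apply_simps(3,6) S g)
  ultimately show ?thesis unfolding invertible_bop_def by blast
qed

section \<open>Norm-holomorphic functions\<close>

lemma bounded_bilinear_scaleC:
  "bounded_bilinear ((*\<^sub>C) :: complex \<Rightarrow> 'a \<Rightarrow> 'a::complex_normed_vector)"
  by (rule bounded_bilinear.intro)
    (auto simp: scaleC_add_left scaleC_add_right scaleR_scaleC scaleC_scaleC norm_scaleC
      mult.commute scaleR_conv_of_real intro!: exI[of _ 1])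

text \<open>Off \<open>z\<close> the remainders in the two limits have the same norm. The
  reformulation gives access to the rules for \<open>has_derivative\<close>.\<close>

lemma norm_holomorphic_on_iff_has_derivative:
  "norm_holomorphic_on f X \<longleftrightarrow>
    (\<forall>z\<in>X. \<exists>D. (f has_derivative (\<lambda>h. h *\<^sub>C D)) (at z within X))"
proof -
  have "((\<lambda>w. inverse (w - z) *\<^sub>C (f w - f z)) \<longlongrightarrow> D) (at z within X) \<longleftrightarrow>
      (f has_derivative (\<lambda>h. h *\<^sub>C D)) (at z within X)" for z D
  proof -
    have "norm (inverse (w - z) *\<^sub>C (f w - f z) - D)
        = norm (f w - f z - (w - z) *\<^sub>C D) / norm (w - z)" if "w \<noteq> z" for w
    proof -
      have "inverse (w - z) *\<^sub>C (f w - f z) - D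
          = inverse (w - z) *\<^sub>C (f w - f z - (w - z) *\<^sub>C D)"
        using that by (simp add: complex_vector.scale_right_diff_distrib scaleC_scaleC scaleC_one)
      then show ?thesis
        by (simp add: norm_scaleC norm_inverse divide_inverse mult.commute)
    qed
    then have "((\<lambda>w. norm (inverse (w - z) *\<^sub>C (f w - f z) - D)) \<longlongrightarrow> 0) (at z within X) \<longleftrightarrow>
        ((\<lambda>w. norm (f w - f z - (w - z) *\<^sub>C D) / norm (w - z)) \<longlongrightarrow> 0) (at z within X)"
      by (intro filterlim_cong refl) (simp add: eventually_at_filter)
    then show ?thesis
      by (simp add: has_derivative_iff_norm tendsto_norm_zero_iff LIM_zero_iff
        bounded_bilinear.bounded_linear_left[OF bounded_bilinear_scaleC])
  qed
  then show ?thesis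
    unfolding norm_holomorphic_on_def by simp
qed

lemma norm_holomorphic_on_subset:
  "norm_holomorphic_on f X \<Longrightarrow> Y \<subseteq> X \<Longrightarrow> norm_holomorphic_on f Y"
  unfolding norm_holomorphic_on_iff_has_derivative by (meson has_derivative_subset subsetD)

lemma norm_holomorphic_on_const: "norm_holomorphic_on (\<lambda>_. c) X"
  unfolding norm_holomorphic_on_iff_has_derivative
  by (auto intro!: exI[of _ 0] derivative_eq_intros)

lemma norm_holomorphic_on_add:
  assumes "norm_holomorphic_on f X" "norm_holomorphic_on g X"
  shows "norm_holomorphic_on (\<lambda>z. f z + g z) X"
  unfolding norm_holomorphic_on_iff_has_derivative
proof
  fix z assume "z \<in> X"
  with assms obtain D D' where
    "(f has_derivative (\<lambda>h. h *\<^sub>C D)) (at z within X)"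
    "(g has_derivative (\<lambda>h. h *\<^sub>C D')) (at z within X)"
    unfolding norm_holomorphic_on_iff_has_derivative by metis
  from has_derivative_add[OF this]
  have "((\<lambda>z. f z + g z) has_derivative (\<lambda>h. h *\<^sub>C (D + D'))) (at z within X)"
    by (simp add: scaleC_add_right)
  then show "\<exists>D. ((\<lambda>z. f z + g z) has_derivative (\<lambda>h. h *\<^sub>C D)) (at z within X)" ..
qed

lemma norm_holomorphic_on_diff:
  assumes "norm_holomorphic_on f X" "norm_holomorphic_on g X"
  shows "norm_holomorphic_on (\<lambda>z. f z - g z) X"
  unfolding norm_holomorphic_on_iff_has_derivative
proof
  fix z assume "z \<in> X"
  with assms obtain D D' where
    "(f has_derivative (\<lambda>h. h *\<^sub>C D)) (at z within X)"
    "(g has_derivative (\<lambda>h. h *\<^sub>C D')) (at z within X)"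
    unfolding norm_holomorphic_on_iff_has_derivative by metis
  from has_derivative_diff[OF this]
  have "((\<lambda>z. f z - g z) has_derivative (\<lambda>h. h *\<^sub>C (D - D'))) (at z within X)"
    by (simp add: complex_vector.scale_right_diff_distrib)
  then show "\<exists>D. ((\<lambda>z. f z - g z) has_derivative (\<lambda>h. h *\<^sub>C D)) (at z within X)" ..
qed

lemma norm_holomorphic_on_mult:
  fixes f g :: "complex \<Rightarrow> 'a::complex_normed_vector bop"
  assumes "norm_holomorphic_on f X" "norm_holomorphic_on g X"
  shows "norm_holomorphic_on (\<lambda>z. f z * g z) X"
  unfolding norm_holomorphic_on_iff_has_derivative
proof
  fix z assume "z \<in> X"
  with assms obtain D D' where
    "(f has_derivative (\<lambda>h. h *\<^sub>C D)) (at z within X)"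
    "(g has_derivative (\<lambda>h. h *\<^sub>C D')) (at z within X)"
    unfolding norm_holomorphic_on_iff_has_derivative by metis
  from has_derivative_mult[OF this]
  have "((\<lambda>z. f z * g z) has_derivative (\<lambda>h. h *\<^sub>C (f z * D' + D * g z))) (at z within X)"
    by (simp add: scaleC_add_right)
  then show "\<exists>D. ((\<lambda>z. f z * g z) has_derivative (\<lambda>h. h *\<^sub>C D)) (at z within X)" ..
qed

lemma norm_holomorphic_on_scaleC:
  fixes f :: "complex \<Rightarrow> 'a::complex_normed_vector"
  assumes "c holomorphic_on X" "norm_holomorphic_on f X"
  shows "norm_holomorphic_on (\<lambda>z. c z *\<^sub>C f z) X"
  unfolding norm_holomorphic_on_iff_has_derivative
proof
  fix z assume "z \<in> X"
  with assms obtain d D where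
    "(c has_derivative (*) d) (at z within X)"
    "(f has_derivative (\<lambda>h. h *\<^sub>C D)) (at z within X)"
    unfolding norm_holomorphic_on_iff_has_derivative holomorphic_on_def
      field_differentiable_def has_field_derivative_def by metis
  from bounded_bilinear.FDERIV[OF bounded_bilinear_scaleC this]
  have "((\<lambda>z. c z *\<^sub>C f z) has_derivative (\<lambda>h. h *\<^sub>C (c z *\<^sub>C D + d *\<^sub>C f z))) (at z within X)"
    by (simp add: scaleC_add_right scaleC_scaleC mult.commute)
  then show "\<exists>D. ((\<lambda>z. c z *\<^sub>C f z) has_derivative (\<lambda>h. h *\<^sub>C D)) (at z within X)" ..
qed

lemma norm_holomorphic_on_compose:
  assumes "c holomorphic_on X" "norm_holomorphic_on f X" "c ` X \<subseteq> X"
  shows "norm_holomorphic_on (\<lambda>z. f (c z)) X"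
  unfolding norm_holomorphic_on_iff_has_derivative
proof
  fix z assume z: "z \<in> X"
  with assms obtain d where d: "(c has_derivative (*) d) (at z within X)"
    unfolding holomorphic_on_def field_differentiable_def has_field_derivative_def by metis
  from z assms(2,3) obtain D where "(f has_derivative (\<lambda>h. h *\<^sub>C D)) (at (c z) within X)"
    unfolding norm_holomorphic_on_iff_has_derivative by blast
  then have "(f has_derivative (\<lambda>h. h *\<^sub>C D)) (at (c z) within c ` X)"
    using assms(3) by (rule has_derivative_subset)
  from has_derivative_in_compose[OF d this]
  have "((\<lambda>z. f (c z)) has_derivative (\<lambda>h. h *\<^sub>C (d *\<^sub>C D))) (at z within X)"
    by (simp add: scaleC_scaleC mult.commute)
  then show "\<exists>D. ((\<lambda>z. f (c z)) has_derivative (\<lambda>h. h *\<^sub>C D)) (at z within X)" ..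
qed

text \<open>Two conjugations cancel: \<open>cnj\<close> and \<open>adj\<close> are each only
  real-linear, but the derivative of the composite is again complex-linear in
  \<open>h\<close>.\<close>

lemma norm_holomorphic_on_adj_cnj:
  fixes f :: "complex \<Rightarrow> 'h::separable_hilbert_space bop"
  assumes "norm_holomorphic_on f X" "cnj ` X \<subseteq> X"
  shows "norm_holomorphic_on (\<lambda>z. adj (f (cnj z))) X"
  unfolding norm_holomorphic_on_iff_has_derivative
proof
  fix z assume "z \<in> X"
  with assms obtain D where "(f has_derivative (\<lambda>h. h *\<^sub>C D)) (at (cnj z) within X)"
    unfolding norm_holomorphic_on_iff_has_derivative by blast
  then have "(f has_derivative (\<lambda>h. h *\<^sub>C D)) (at (cnj z) within cnj ` X)"
    using assms(2) by (rule has_derivative_subset)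
  from has_derivative_in_compose[OF bounded_linear_imp_has_derivative[OF bounded_linear_cnj] this]
  have "((\<lambda>z. f (cnj z)) has_derivative (\<lambda>h. cnj h *\<^sub>C D)) (at z within X)" .
  from bounded_linear.has_derivative[OF bounded_linear_adj this]
  have "((\<lambda>z. adj (f (cnj z))) has_derivative (\<lambda>h. h *\<^sub>C adj D)) (at z within X)"
    by (simp add: adj_scaleC)
  then show "\<exists>D. ((\<lambda>z. adj (f (cnj z))) has_derivative (\<lambda>h. h *\<^sub>C D)) (at z within X)" ..
qed

section \<open>The identity theorem for operator-valued functions\<close>

lemma bounded_linear_matrix_coefficient:
  "bounded_linear (\<lambda>T :: 'h::separable_hilbert_space bop. cinner x (bop_apply T y))"
proof (rule bounded_linear_intro[where K = "norm x * norm y"])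
  fix T :: "'h bop"
  have "cmod (cinner x (bop_apply T y)) \<le> norm x * (norm T * norm y)"
    by (rule order_trans[OF cmod_cinner_le mult_left_mono[OF norm_bop_apply]]) simp
  then show "norm (cinner x (bop_apply T y)) \<le> norm T * (norm x * norm y)"
    by (simp add: mult_ac)
qed (simp_all add: cinner_add_right cinner_scaleC_right scaleR_scaleC scaleR_conv_of_real)

text \<open>Each matrix coefficient is a scalar holomorphic function vanishing on the unit circle,
  so the scalar identity theorem applies to it, and an operator with zero matrix coefficients is
  zero.\<close>

lemma norm_holomorphic_continuation:
  fixes f :: "complex \<Rightarrow> 'h::separable_hilbert_space bop"
  assumes f: "norm_holomorphic_on f X" and X: "open X" "connected X" "sphere 0 1 \<subseteq> X"
    and zero: "\<And>z. cmod z = 1 \<Longrightarrow> f z = 0" and w: "w \<in> X"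
  shows "f w = 0"
proof (rule bop_eqI, rule cinner_right_eqI)
  fix x y
  have holo: "(\<lambda>z. cinner x (bop_apply (f z) y)) holomorphic_on X"
    unfolding holomorphic_on_def field_differentiable_def has_field_derivative_def
  proof
    fix z assume "z \<in> X"
    with f obtain D where "(f has_derivative (\<lambda>h. h *\<^sub>C D)) (at z within X)"
      unfolding norm_holomorphic_on_iff_has_derivative by blast
    from bounded_linear.has_derivative[OF bounded_linear_matrix_coefficient this]
    have "((\<lambda>z. cinner x (bop_apply (f z) y)) has_derivative (*) (cinner x (bop_apply D y)))
        (at z within X)"
      by (rule has_derivative_eq_rhs) (simp add: cinner_scaleC_right mult.commute fun_eq_iff)
    then show "\<exists>f'. ((\<lambda>z. cinner x (bop_apply (f z) y)) has_derivative (*) f') (at z within X)" ..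
  qed
  \<comment> \<open>A connected set with more than one point has no isolated points, so the zeros on
    the circle accumulate at 1, a point of \<open>X\<close>.\<close>
  have lim: "(1::complex) islimpt sphere 0 1"
  proof (rule connected_imp_perfect)
    show "connected (sphere (0::complex) 1)" by (simp add: connected_sphere)
    show "sphere (0::complex) 1 \<noteq> {a}" for a
    proof
      assume a: "sphere (0::complex) 1 = {a}"
      have "1 \<in> sphere (0::complex) 1" "-1 \<in> sphere (0::complex) 1" by simp_all
      then show False unfolding a by simp
    qed
  qed simp
  have "cinner x (bop_apply (f w) y) = 0"
    by (rule analytic_continuation[OF holo X _ lim _ w]) (use X(3) zero in auto)
  then show "cinner x (bop_apply (f w) y) = cinner x (bop_apply 0 y)" by simp
qed

section \<open>Wronskians and fundamental systems\<close>

text \<open>The transposed recursion, with coefficients on the right, is the one satisfied by the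
  adjoints of a solution; the Wronskian pairs its solutions with those of the original
  recursion.\<close>

definition left_solution ::
  "(int \<Rightarrow> 'h::separable_hilbert_space bop) \<Rightarrow> (int \<Rightarrow> 'h bop) \<Rightarrow> complex \<Rightarrow> (int \<Rightarrow> 'h bop) \<Rightarrow> bool" where
  "left_solution A B lam U \<longleftrightarrow>
    (\<forall>n. U (n - 1) * A (n - 1) + U n * B n + U (n + 1) * A n = lam *\<^sub>C U n)"

lemma op_solution_adj:
  assumes "\<And>n. selfadjoint (A n)" "\<And>n. selfadjoint (B n)" "op_solution A B lam U"
  shows "left_solution A B (cnj lam) (\<lambda>n. adj (U n))"
  unfolding left_solution_def
proof
  fix n
  have "adj (A (n - 1) * U (n - 1) + B n * U n + A n * U (n + 1)) = adj (lam *\<^sub>C U n)"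
    using assms(3) by (simp add: op_solution_def)
  then show "adj (U (n - 1)) * A (n - 1) + adj (U n) * B n + adj (U (n + 1)) * A n
      = cnj lam *\<^sub>C adj (U n)"
    using assms(1,2) by (simp add: adj_add adj_mult adj_scaleC selfadjoint_def)
qed

lemma int_shift_const:
  assumes "\<And>n::int. f (n + 1) = f n"
  shows "f n = f m"
proof (induction n rule: int_induct[of _ m])
  case (step2 i)
  then show ?case using assms[of "i - 1"] by simp
qed (simp_all add: assms)

text \<open>The two recursions eliminate the terms with index \<open>n + 1\<close>; the
  contributions of \<open>lam\<close> and \<open>B n\<close> then cancel.\<close>

lemma wronskian_at_const:
  assumes U: "left_solution A B lam U" and V: "op_solution A B lam V"
  shows "wronskian_at A U V n = wronskian_at A U V m"
proof (rule int_shift_const)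
  fix n
  have "A n * V (n + 1) = lam *\<^sub>C V n - B n * V n - A (n - 1) * V (n - 1)"
    using V[unfolded op_solution_def, rule_format, of n] by (simp add: algebra_simps)
  moreover have "U (n + 1) * A n = lam *\<^sub>C U n - U n * B n - U (n - 1) * A (n - 1)"
    using U[unfolded left_solution_def, rule_format, of n] by (simp add: algebra_simps)
  moreover have "wronskian_at A U V (n + 1) = U n * (A n * V (n + 1)) - U (n + 1) * A n * V n"
    by (simp add: wronskian_at_def mult.assoc)
  ultimately have "wronskian_at A U V (n + 1)
      = U n * (lam *\<^sub>C V n - B n * V n - A (n - 1) * V (n - 1))
        - (lam *\<^sub>C U n - U n * B n - U (n - 1) * A (n - 1)) * V n"
    by simp
  also have "\<dots> = wronskian_at A U V n"
    by (simp add: wronskian_at_def algebra_simps)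
  finally show "wronskian_at A U V (n + 1) = wronskian_at A U V n" .
qed

lemma wronskian_eq:
  assumes "left_solution A B lam U" "op_solution A B lam V"
  shows "wronskian A U V = wronskian_at A U V n"
  unfolding wronskian_def using wronskian_at_const[OF assms] by (intro the_equality) metis+

lemma wronskian_at_mult_right:
  "wronskian_at A U (\<lambda>n. V n * Q) n = wronskian_at A U V n * Q"
  by (simp add: wronskian_at_def algebra_simps)

lemma wronskian_at_add_right:
  "wronskian_at A U (\<lambda>n. V n + V' n) n = wronskian_at A U V n + wronskian_at A U V' n"
  by (simp add: wronskian_at_def algebra_simps)

lemma wronskian_at_diff_right:
  "wronskian_at A U (\<lambda>n. V n - V' n) n = wronskian_at A U V n - wronskian_at A U V' n"
  by (simp add: wronskian_at_def algebra_simps)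

lemma op_solution_mult_right: "op_solution A B lam V \<Longrightarrow> op_solution A B lam (\<lambda>n. V n * Q)"
  unfolding op_solution_def
  by (simp flip: mult.assoc distrib_right)

lemma op_solution_diff:
  assumes "op_solution A B lam V" "op_solution A B lam V'"
  shows "op_solution A B lam (\<lambda>n. V n - V' n)"
  unfolding op_solution_def
proof
  fix n
  have "A (n - 1) * V (n - 1) + B n * V n + A n * V (n + 1)
      - (A (n - 1) * V' (n - 1) + B n * V' n + A n * V' (n + 1)) = lam *\<^sub>C V n - lam *\<^sub>C V' n"
    using assms by (simp add: op_solution_def)
  then show "A (n - 1) * (V (n - 1) - V' (n - 1)) + B n * (V n - V' n)
      + A n * (V (n + 1) - V' (n + 1)) = lam *\<^sub>C (V n - V' n)"
    by (simp add: algebra_simps complex_vector.scale_right_diff_distrib)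
qed

text \<open>Invertibility of every \<open>A n\<close> allows the three-term recursion to be solved
  forwards and backwards, so two adjacent values determine a solution.\<close>

lemma op_solution_eq_0:
  assumes inv: "\<And>n. invertible_bop (A n)" and V: "op_solution A B lam V"
    and "V m = 0" "V (m + 1) = 0"
  shows "V n = 0"
proof -
  note eq = V[unfolded op_solution_def, rule_format]
  have cancel: "X = 0" if "A k * X = 0" for k X
    using invertible_bop_mult_cancel[OF inv, of k X 0] that by simp
  have "V n = 0 \<and> V (n + 1) = 0"
  proof (induction n rule: int_induct[of _ m])
    case (step1 i)
    then show ?case using eq[of "i + 1"] cancel[of "i + 1"] by (simp add: add.assoc)
  next
    case (step2 i)
    then show ?case using eq[of i] cancel[of "i - 1"] by simp
  qed (use assms in simp)
  then show ?thesis ..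
qed

text \<open>The sequences \<open>R\<^sub>n P\<close> are exactly the solutions whose Wronskian with \<open>L\<close> vanishes, and \<open>P\<close> is
  determined by the solution.\<close>

definition exact_pair ::
  "(int \<Rightarrow> 'h::separable_hilbert_space bop) \<Rightarrow> (int \<Rightarrow> 'h bop) \<Rightarrow> complex \<Rightarrow>
    (int \<Rightarrow> 'h bop) \<Rightarrow> (int \<Rightarrow> 'h bop) \<Rightarrow> bool" where
  "exact_pair A B lam L R \<longleftrightarrow>
    left_solution A B lam L \<and> op_solution A B lam R \<and> (\<forall>n. wronskian_at A L R n = 0) \<and>
    (\<forall>V. op_solution A B lam V \<longrightarrow> (\<forall>n. wronskian_at A L V n = 0) \<longrightarrow> (\<exists>P. \<forall>n. V n = R n * P)) \<and>
    (\<forall>P. (\<forall>n. R n * P = 0) \<longrightarrow> P = 0)"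

lemma exact_pair_of_invertible:
  assumes inv: "\<And>n. invertible_bop (A n)"
    and sol: "left_solution A B lam L" "op_solution A B lam R"
    and wr: "\<And>n. wronskian_at A L R n = 0"
    and m: "invertible_bop (L m)" "invertible_bop (R m)"
  shows "exact_pair A B lam L R"
  unfolding exact_pair_def
proof (intro conjI allI impI sol wr)
  fix V assume V: "op_solution A B lam V" and W: "\<forall>n. wronskian_at A L V n = 0"
  obtain S where S: "R m * S = 1" using m(2) unfolding invertible_bop_def by blast
  define X where "X = (\<lambda>n. V n - R n * (S * V m))"
  have X: "op_solution A B lam X"
    unfolding X_def by (intro op_solution_diff op_solution_mult_right V sol)
  have "wronskian_at A L X (m + 1) = 0"
    unfolding X_def by (simp add: wronskian_at_diff_right wronskian_at_mult_right W wr)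
  moreover have Xm: "X m = 0"
    unfolding X_def mult.assoc[symmetric] S by simp
  \<comment> \<open>In \<open>wronskian_at A L X (m + 1)\<close> the second term carries the factor
    \<open>X m\<close>, which vanishes.\<close>
  ultimately have "L m * (A m * X (m + 1)) = L m * (A m * 0)"
    by (simp add: wronskian_at_def mult.assoc)
  then have "X (m + 1) = 0"
    using invertible_bop_mult_cancel[OF m(1)] invertible_bop_mult_cancel[OF inv] by blast
  then have "X n = 0" for n
    by (rule op_solution_eq_0[OF inv X Xm])
  then have "V n = R n * (S * V m)" for n
    unfolding X_def right_minus_eq .
  then show "\<exists>P. \<forall>n. V n = R n * P" by blast
next
  fix P assume "\<forall>n. R n * P = 0"
  then have "R m * P = R m * 0" by simp
  then show "P = 0" using invertible_bop_mult_cancel[OF m(2)] by blast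
qed

lemma exact_pair_span:
  assumes ex: "exact_pair A B lam L R" and S: "op_solution A B lam S"
    and W: "invertible_bop (wronskian A L S)" and V: "op_solution A B lam V"
  shows "\<exists>P Q. \<forall>n. V n = R n * P + S n * Q"
proof -
  have L: "left_solution A B lam L" using ex by (simp add: exact_pair_def)
  obtain T where T: "wronskian A L S * T = 1" using W unfolding invertible_bop_def by blast
  \<comment> \<open>Pairing with \<open>L\<close> annihilates multiples of \<open>R\<close>, so
    \<open>Q\<close> has to be chosen such that the Wronskian of \<open>L\<close> with
    \<open>V n - S n * Q\<close> vanishes.\<close>
  define Q where "Q = T * wronskian A L V"
  have "wronskian_at A L (\<lambda>n. V n - S n * Q) n = 0" for n
    unfolding wronskian_at_diff_right wronskian_at_mult_right
      wronskian_eq[OF L S, of n, symmetric] wronskian_eq[OF L V, of n, symmetric] Q_def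
      mult.assoc[symmetric] T by simp
  moreover have "op_solution A B lam (\<lambda>n. V n - S n * Q)"
    by (intro op_solution_diff op_solution_mult_right V S)
  ultimately obtain P where "\<And>n. V n - S n * Q = R n * P"
    using ex unfolding exact_pair_def by blast
  then show ?thesis by (metis diff_eq_eq)
qed

text \<open>Pairing with \<open>L\<close> removes the term with \<open>R\<close> and leaves
  \<open>wronskian A L S * Q = 0\<close>, hence \<open>Q = 0\<close>; the last clause of
  \<open>exact_pair\<close> then gives \<open>P = 0\<close>.\<close>

lemma exact_pair_independent:
  assumes ex: "exact_pair A B lam L R" and S: "op_solution A B lam S"
    and W: "invertible_bop (wronskian A L S)" and 0: "\<And>n. R n * P + S n * Q = 0"
  shows "P = 0 \<and> Q = 0"
proof -
  have L: "left_solution A B lam L" and LR: "\<And>n. wronskian_at A L R n = 0"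
    using ex by (auto simp: exact_pair_def)
  have "wronskian_at A L (\<lambda>n. R n * P + S n * Q) n = 0" for n
    unfolding 0 by (simp add: wronskian_at_def)
  then have "wronskian A L S * Q = wronskian A L S * 0"
    unfolding wronskian_at_add_right wronskian_at_mult_right LR
    by (simp add: wronskian_eq[OF L S, of 0])
  then have "Q = 0" using invertible_bop_mult_cancel[OF W] by blast
  then show ?thesis using 0 ex unfolding exact_pair_def by auto
qed

text \<open>A solution annihilated by \<open>L'\<close> is first expanded in \<open>R\<close> and
  \<open>S\<close>; pairing with \<open>L'\<close> removes the part with \<open>S\<close> and forces
  the coefficient of \<open>R\<close> to vanish. This transfers exactness from
  \<open>inverse z\<close> to \<open>z\<close> when \<open>z\<close> lies outside the unit
  disc.\<close>

lemma exact_pair_swap: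
  assumes ex: "exact_pair A B lam L R"
    and sol: "left_solution A B lam L'" "op_solution A B lam S"
    and LS: "invertible_bop (wronskian A L S)"
    and L'S: "\<And>n. wronskian_at A L' S n = 0"
    and L'R: "invertible_bop (wronskian A L' R)"
  shows "exact_pair A B lam L' S"
  unfolding exact_pair_def
proof (intro conjI allI impI sol L'S)
  fix V assume V: "op_solution A B lam V" and W: "\<forall>n. wronskian_at A L' V n = 0"
  obtain P Q where PQ: "\<And>n. V n = R n * P + S n * Q"
    using exact_pair_span[OF ex sol(2) LS V] by blast
  have R: "op_solution A B lam R" using ex by (simp add: exact_pair_def)
  have "wronskian_at A L' (\<lambda>n. R n * P + S n * Q) 0 = 0"
    using W by (simp flip: PQ)
  then have "wronskian A L' R * P = wronskian A L' R * 0"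
    unfolding wronskian_at_add_right wronskian_at_mult_right L'S
    by (simp add: wronskian_eq[OF sol(1) R, of 0])
  then have "P = 0" using invertible_bop_mult_cancel[OF L'R] by blast
  then show "\<exists>P. \<forall>n. V n = S n * P" using PQ by auto
next
  fix Q assume "\<forall>n. S n * Q = 0"
  then show "Q = 0" using exact_pair_independent[OF ex sol(2) LS, of 0 Q] by simp
qed

lemma ex_rank_one:
  fixes e :: "'h::separable_hilbert_space"
  shows "\<exists>K. \<forall>u x. bop_apply (K u) x = cinner e x *\<^sub>C u"
proof -
  have "\<exists>T. \<forall>x. bop_apply T x = cinner e x *\<^sub>C u" for u
  proof (rule ex_bop)
    show "norm (cinner e x *\<^sub>C u) \<le> (norm e * norm u) * norm x" for x
      using mult_right_mono[OF cmod_cinner_le[of e x], of "norm u"]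
      by (simp add: norm_scaleC mult_ac)
  qed (simp_all add: cinner_add_right cinner_scaleC_right scaleC_add_left scaleC_scaleC)
  then show ?thesis by metis
qed

text \<open>Vector solutions are reduced to operator solutions of rank one.\<close>

lemma fundamental_systemI:
  fixes A B :: "int \<Rightarrow> 'h::separable_hilbert_space bop"
  assumes ex: "exact_pair A B lam L R" and S: "op_solution A B lam S"
    and W: "invertible_bop (wronskian A L S)"
  shows "fundamental_system A B lam R S"
  unfolding fundamental_system_def
proof (intro conjI allI impI S)
  show "op_solution A B lam R" using ex by (simp add: exact_pair_def)
next
  fix V assume V: "op_solution A B lam V"
  show "\<exists>!(P, Q). \<forall>n. V n = R n * P + S n * Q"
  proof (rule ex_ex1I)
    show "\<exists>x. case x of (P, Q) \<Rightarrow> \<forall>n. V n = R n * P + S n * Q"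
      using exact_pair_span[OF ex S W V] by simp
  next
    fix x y
    assume x: "case x of (P, Q) \<Rightarrow> \<forall>n. V n = R n * P + S n * Q"
      and y: "case y of (P, Q) \<Rightarrow> \<forall>n. V n = R n * P + S n * Q"
    have "R n * fst x + S n * snd x = R n * fst y + S n * snd y" for n
      by (rule trans[OF x[unfolded case_prod_beta, rule_format, symmetric]
        y[unfolded case_prod_beta, rule_format]])
    then have "R n * (fst x - fst y) + S n * (snd x - snd y) = 0" for n
      by (simp add: algebra_simps)
    from exact_pair_independent[OF ex S W this] show "x = y"
      by (simp add: prod_eq_iff)
  qed
next
  fix v assume v: "vec_solution A B lam v"
  have vec: "(\<exists>p q. \<forall>n. v n = bop_apply (R n) p + bop_apply (S n) q) \<and>
    (\<forall>p q. (\<forall>n. bop_apply (R n) p + bop_apply (S n) q = 0) \<longrightarrow> p = 0 \<and> q = 0)"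
  proof -
    \<comment> \<open>A unit vector exists unless the space is trivial, and in the trivial space any
      two vectors agree.\<close>
    consider (zero) "\<And>x::'h. x = 0" | (unit) e :: 'h where "cinner e e = 1"
    proof (cases "\<exists>x::'h. x \<noteq> 0")
      case True
      then obtain x :: 'h where "x \<noteq> 0" by blast
      then have "cinner (complex_of_real (1 / norm x) *\<^sub>C x) (complex_of_real (1 / norm x) *\<^sub>C x) = 1"
        by (simp add: cinner_norm norm_scaleC norm_divide)
      then show ?thesis by (rule that(2))
    qed (use that in blast)
    then show ?thesis
    proof cases
      case zero
      have "x = y" for x y :: 'h
        using zero[of x] zero[of y] by simp
      then show ?thesis by (intro conjI exI allI impI)
    next
      case unit
      obtain K where K: "\<And>u x. bop_apply (K u) x = cinner e x *\<^sub>C u"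
        using ex_rank_one by blast
      \<comment> \<open>Evaluation at \<open>e\<close> recovers a vector from its rank-one
        operator.\<close>
      have Ke: "bop_apply (K u) e = u" for u
        by (simp add: K unit scaleC_one)
      have "op_solution A B lam (\<lambda>n. K (v n))"
        unfolding op_solution_def
      proof (intro allI bop_eqI)
        fix n x
        have "cinner e x *\<^sub>C (bop_apply (A (n - 1)) (v (n - 1)) + bop_apply (B n) (v n)
            + bop_apply (A n) (v (n + 1))) = cinner e x *\<^sub>C lam *\<^sub>C v n"
          using v by (simp add: vec_solution_def)
        then show "bop_apply (A (n - 1) * K (v (n - 1)) + B n * K (v n) + A n * K (v (n + 1))) x
            = bop_apply (lam *\<^sub>C K (v n)) x"
          by (simp add: K scaleC_add_right scaleC_scaleC mult.commute)
      qed
      from exact_pair_span[OF ex S W this] obtain P Q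
        where PQ: "\<And>n. K (v n) = R n * P + S n * Q" by blast
      have "v n = bop_apply (R n) (bop_apply P e) + bop_apply (S n) (bop_apply Q e)" for n
        using Ke[of "v n"] by (simp add: PQ)
      moreover have "p = 0 \<and> q = 0"
        if 0: "\<forall>n. bop_apply (R n) p + bop_apply (S n) q = 0" for p q
      proof -
        have "R n * K p + S n * K q = 0" for n
          by (rule bop_eqI) (simp add: K 0 flip: scaleC_add_right)
        from exact_pair_independent[OF ex S W this] have "K p = 0" "K q = 0" by simp_all
        then show ?thesis using Ke[of p] Ke[of q] by simp
      qed
      ultimately show ?thesis by blast
    qed
  qed
  show "\<exists>!(p, q). \<forall>n. v n = bop_apply (R n) p + bop_apply (S n) q"
  proof (rule ex_ex1I)
    show "\<exists>x. case x of (p, q) \<Rightarrow> \<forall>n. v n = bop_apply (R n) p + bop_apply (S n) q"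
      using vec by simp
  next
    fix x y
    assume x: "case x of (p, q) \<Rightarrow> \<forall>n. v n = bop_apply (R n) p + bop_apply (S n) q"
      and y: "case y of (p, q) \<Rightarrow> \<forall>n. v n = bop_apply (R n) p + bop_apply (S n) q"
    have "bop_apply (R n) (fst x) + bop_apply (S n) (snd x)
        = bop_apply (R n) (fst y) + bop_apply (S n) (snd y)" for n
      by (rule trans[OF x[unfolded case_prod_beta, rule_format, symmetric]
        y[unfolded case_prod_beta, rule_format]])
    then have "bop_apply (R n) (fst x - fst y) + bop_apply (S n) (snd x - snd y) = 0" for n
      by (simp add: algebra_simps)
    with vec have "fst x - fst y = 0 \<and> snd x - snd y = 0" by blast
    then show "x = y"
      by (simp add: prod_eq_iff)
  qed
qed

section \<open>Jost solutions\<close>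

text \<open>A constant Wronskian can be computed in the limit along \<open>F\<close>, where the
  operator factors tend to 1 and only the scalar Wronskian \<gamma> of \<open>a\<close> and
  \<open>b\<close> remains. The bound \<open>K\<close> keeps the scalar products from amplifying the
  errors.\<close>

lemma wronskian_eq_limit:
  fixes A :: "int \<Rightarrow> 'h::separable_hilbert_space bop"
  assumes F: "F \<noteq> bot" "filterlim (\<lambda>n::int. n - 1) F F" and A: "(A \<longlongrightarrow> 1) F"
    and E: "(E \<longlongrightarrow> 0) F" "\<And>n. R n = a n *\<^sub>C (1 + E n)"
    and G: "(G \<longlongrightarrow> 0) F" "\<And>n. S n = b n *\<^sub>C (1 + G n)"
    and bdd: "\<forall>\<^sub>F n in F. cmod (a (n - 1) * b n) \<le> K" "\<forall>\<^sub>F n in F. cmod (a n * b (n - 1)) \<le> K"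
    and \<gamma>: "\<And>n. a (n - 1) * b n - a n * b (n - 1) = \<gamma>"
    and W: "\<And>n. wronskian_at A R S n = W"
  shows "W = \<gamma> *\<^sub>C 1"
proof -
  define X where "X = (\<lambda>n. (1 + E (n - 1)) * A (n - 1) * (1 + G n))"
  define Y where "Y = (\<lambda>n. (1 + E n) * A (n - 1) * (1 + G (n - 1)))"
  note shift = filterlim_compose[OF _ F(2)]
  have "(X \<longlongrightarrow> (1 + 0) * 1 * (1 + 0)) F" "(Y \<longlongrightarrow> (1 + 0) * 1 * (1 + 0)) F"
    unfolding X_def Y_def
    by (intro tendsto_mult tendsto_add tendsto_const E G shift[OF A] shift[OF E(1)] shift[OF G(1)])+
  then have XY: "((\<lambda>n. norm (X n - 1)) \<longlongrightarrow> 0) F" "((\<lambda>n. norm (Y n - 1)) \<longlongrightarrow> 0) F"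
    by (simp_all add: tendsto_norm_zero LIM_zero)
  \<comment> \<open>Subtracting 1 from \<open>X n\<close> and \<open>Y n\<close> takes away exactly
    \<gamma>, since \<gamma> is the difference of the two scalar coefficients.\<close>
  have W': "W - \<gamma> *\<^sub>C 1 = (a (n - 1) * b n) *\<^sub>C (X n - 1) - (a n * b (n - 1)) *\<^sub>C (Y n - 1)" for n
    unfolding W[of n, symmetric] \<gamma>[of n, symmetric] wronskian_at_def E(2) G(2) X_def Y_def
    by (simp add: scaleC_scaleC complex_vector.scale_right_diff_distrib
      complex_vector.scale_left_diff_distrib mult.commute[of "b _"])
  have "((\<lambda>n. W - \<gamma> *\<^sub>C 1) \<longlongrightarrow> 0) F"
  proof (rule Lim_null_comparison)
    show "\<forall>\<^sub>F n in F. norm (W - \<gamma> *\<^sub>C 1) \<le> K * norm (X n - 1) + K * norm (Y n - 1)"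
      using bdd
    proof eventually_elim
      case (elim n)
      have "norm (W - \<gamma> *\<^sub>C 1)
          \<le> cmod (a (n - 1) * b n) * norm (X n - 1) + cmod (a n * b (n - 1)) * norm (Y n - 1)"
        unfolding W'[of n] norm_scaleC[symmetric] by (rule norm_triangle_ineq4)
      also have "\<dots> \<le> K * norm (X n - 1) + K * norm (Y n - 1)"
        using elim by (intro add_mono mult_right_mono) auto
      finally show ?case .
    qed
    show "((\<lambda>n. K * norm (X n - 1) + K * norm (Y n - 1)) \<longlongrightarrow> 0) F"
      using tendsto_add[OF tendsto_mult_right_zero[OF XY(1)] tendsto_mult_right_zero[OF XY(2)]]
      by simp
  qed
  then show ?thesis
    using F(1) by (simp add: tendsto_const_iff)
qed

text \<open>Both Jost solutions at once: \<open>F\<close> is \<open>at_top\<close> with \<open>\<sigma> = 1\<close>, or \<open>at_bot\<close> with \<open>\<sigma> = -1\<close>.\<close>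

locale jost_solution =
  fixes A B :: "int \<Rightarrow> 'h::separable_hilbert_space bop"
    and F :: "int filter" and \<sigma> :: int and U :: "complex \<Rightarrow> int \<Rightarrow> 'h bop"
  assumes selfadj: "\<And>n. selfadjoint (A n)" "\<And>n. selfadjoint (B n)"
    and inv: "\<And>n. invertible_bop (A n)"
    and F: "F \<noteq> bot" "filterlim (\<lambda>n. n - 1) F F"
    and \<sigma>: "\<sigma> = 1 \<or> \<sigma> = - 1" "\<forall>\<^sub>F n in F. \<sigma> * n \<ge> 1"
    and A_lim: "(A \<longlongrightarrow> 1) F"
    and sol: "\<And>z. 0 < cmod z \<Longrightarrow> cmod z \<le> 1 \<Longrightarrow> op_solution A B (z + inverse z) (U z)"
    and asymp: "\<And>z. 0 < cmod z \<Longrightarrow> cmod z \<le> 1 \<Longrightarrow>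
      \<exists>E. (E \<longlongrightarrow> 0) F \<and> (\<forall>n. U z n = (z powi (\<sigma> * n)) *\<^sub>C (1 + E n))"
begin

text \<open>Conjugating the argument compensates for the adjoint: \<open>L z\<close> belongs to the
  same spectral parameter as \<open>U z\<close>, has the same scalar factor in its asymptotics, and
  depends holomorphically on \<open>z\<close> where \<open>U z\<close> does.\<close>

definition L :: "complex \<Rightarrow> int \<Rightarrow> 'h bop" where
  "L z n = adj (U (cnj z) n)"

lemma left_solution_L_of:
  assumes "op_solution A B (cnj z + inverse (cnj z)) (U (cnj z))"
  shows "left_solution A B (z + inverse z) (L z)"
  using op_solution_adj[OF selfadj assms] by (simp add: L_def[abs_def])

lemma left_solution_L: "0 < cmod z \<Longrightarrow> cmod z \<le> 1 \<Longrightarrow> left_solution A B (z + inverse z) (L z)"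
  by (rule left_solution_L_of) (simp add: sol)

lemma L_asymp:
  assumes "0 < cmod z" "cmod z \<le> 1"
  shows "\<exists>E. (E \<longlongrightarrow> 0) F \<and> (\<forall>n. L z n = (z powi (\<sigma> * n)) *\<^sub>C (1 + E n))"
proof -
  obtain E where E: "(E \<longlongrightarrow> 0) F" "\<And>n. U (cnj z) n = (cnj z powi (\<sigma> * n)) *\<^sub>C (1 + E n)"
    using asymp[of "cnj z"] assms by auto
  have "((\<lambda>n. adj (E n)) \<longlongrightarrow> 0) F"
    using bounded_linear.tendsto_zero[OF bounded_linear_adj E(1)] .
  moreover have "L z n = (z powi (\<sigma> * n)) *\<^sub>C (1 + adj (E n))" for n
    by (simp add: L_def E(2) adj_scaleC adj_add flip: complex_cnj_power_int)
  ultimately show ?thesis by blast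
qed

text \<open>Both sequences have the scalar factor \<open>z powi (\<sigma> * n)\<close>, so the
  scalar Wronskian is zero.\<close>

lemma wronskian_self:
  assumes z: "0 < cmod z" "cmod z \<le> 1"
  shows "wronskian_at A (L z) (U z) n = 0"
proof -
  obtain E where E: "(E \<longlongrightarrow> 0) F" "\<And>n. L z n = (z powi (\<sigma> * n)) *\<^sub>C (1 + E n)"
    using L_asymp[OF z] by blast
  obtain G where G: "(G \<longlongrightarrow> 0) F" "\<And>n. U z n = (z powi (\<sigma> * n)) *\<^sub>C (1 + G n)"
    using asymp[OF z] by blast
  have prod: "z powi (\<sigma> * m) * z powi (\<sigma> * k) = z powi (\<sigma> * (m + k))" for m k
    using z by (subst power_int_add[symmetric]) (auto simp: algebra_simps)
  \<comment> \<open>The exponents add up to \<open>\<sigma> * (2 * n - 1)\<close>, which is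
    eventually nonnegative along \<open>F\<close>; there the power is bounded because
    \<open>cmod z \<le> 1\<close>.\<close>
  have bdd: "\<forall>\<^sub>F n in F. cmod (z powi (\<sigma> * (2 * n - 1))) \<le> 1"
    using \<sigma>(2)
  proof eventually_elim
    case (elim n)
    then have "\<sigma> * (2 * n - 1) \<ge> 0" using \<sigma>(1) by auto
    then show ?case
      using z by (simp add: norm_power power_int_def power_le_one)
  qed
  have "wronskian_at A (L z) (U z) n = 0 *\<^sub>C 1"
  proof (rule wronskian_eq_limit[OF F A_lim E G])
    show "\<forall>\<^sub>F n in F. cmod (z powi (\<sigma> * (n - 1)) * z powi (\<sigma> * n)) \<le> 1"
      and "\<forall>\<^sub>F n in F. cmod (z powi (\<sigma> * n) * z powi (\<sigma> * (n - 1))) \<le> 1"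
      using bdd unfolding prod by (simp_all add: algebra_simps)
    show "wronskian_at A (L z) (U z) m = wronskian_at A (L z) (U z) n" for m
      by (rule wronskian_at_const[OF left_solution_L sol]) (use z in auto)
  qed simp
  then show ?thesis by simp
qed

lemma sol_inverse: "cmod z = 1 \<Longrightarrow> op_solution A B (z + inverse z) (U (inverse z))"
  using sol[of "inverse z"] by (simp add: norm_inverse add.commute)

text \<open>On the unit circle both \<open>z\<close> and \<open>inverse z\<close> lie in the closed
  disc, so both asymptotics are available; the scalar products have modulus 1 and their exponents
  differ by one step, which leaves the powers \<open>-\<sigma>\<close> and \<sigma>.\<close>

lemma wronskian_inverse:
  assumes z: "cmod z = 1"
  shows "wronskian_at A (L z) (U (inverse z)) n = (z powi (- \<sigma>) - z powi \<sigma>) *\<^sub>C 1"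
proof -
  have z': "0 < cmod z" "cmod z \<le> 1" "0 < cmod (inverse z)" "cmod (inverse z) \<le> 1"
    using z by (auto simp: norm_inverse)
  obtain E where E: "(E \<longlongrightarrow> 0) F" "\<And>n. L z n = (z powi (\<sigma> * n)) *\<^sub>C (1 + E n)"
    using L_asymp[OF z'(1,2)] by blast
  obtain G where G: "(G \<longlongrightarrow> 0) F" "\<And>n. U (inverse z) n = (inverse z powi (\<sigma> * n)) *\<^sub>C (1 + G n)"
    using asymp[OF z'(3,4)] by blast
  have prod: "z powi (\<sigma> * m) * inverse z powi (\<sigma> * k) = z powi (\<sigma> * (m - k))" for m k
    using z' by (auto simp: power_int_inverse right_diff_distrib power_int_diff divide_inverse)
  show ?thesis
  proof (rule wronskian_eq_limit[OF F A_lim E G])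
    show "\<forall>\<^sub>F n in F. cmod (z powi (\<sigma> * (n - 1)) * inverse z powi (\<sigma> * n)) \<le> 1"
      and "\<forall>\<^sub>F n in F. cmod (z powi (\<sigma> * n) * inverse z powi (\<sigma> * (n - 1))) \<le> 1"
      using z by (simp_all add: norm_mult norm_power_int norm_inverse)
    show "z powi (\<sigma> * (m - 1)) * inverse z powi (\<sigma> * m)
        - z powi (\<sigma> * m) * inverse z powi (\<sigma> * (m - 1)) = z powi (- \<sigma>) - z powi \<sigma>" for m
      unfolding prod by simp
    show "wronskian_at A (L z) (U (inverse z)) m = wronskian_at A (L z) (U (inverse z)) n" for m
      by (rule wronskian_at_const[OF left_solution_L sol_inverse]) (use z in auto)
  qed
qed

lemma eventually_invertible:
  fixes E :: "int \<Rightarrow> 'h bop"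
  assumes "(E \<longlongrightarrow> 0) F" "z \<noteq> 0"
  shows "\<forall>\<^sub>F n in F. invertible_bop ((z powi (\<sigma> * n)) *\<^sub>C (1 + E n))"
  using order_tendstoD(2)[OF tendsto_norm_zero[OF assms(1)] zero_less_one]
proof eventually_elim
  case (elim n)
  then show ?case
    using assms(2) by (intro invertible_bop_scaleC invertible_bop_one_plus) auto
qed

lemma exact_pair_inside:
  assumes z: "0 < cmod z" "cmod z \<le> 1"
  shows "exact_pair A B (z + inverse z) (L z) (U z)"
proof -
  have z0: "z \<noteq> 0" using z by auto
  obtain E where "(E \<longlongrightarrow> 0) F" "\<And>n. L z n = (z powi (\<sigma> * n)) *\<^sub>C (1 + E n)"
    using L_asymp[OF z] by blast
  then have "\<forall>\<^sub>F n in F. invertible_bop (L z n)"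
    using eventually_invertible[OF _ z0, of E] by simp
  moreover obtain G where "(G \<longlongrightarrow> 0) F" "\<And>n. U z n = (z powi (\<sigma> * n)) *\<^sub>C (1 + G n)"
    using asymp[OF z] by blast
  then have "\<forall>\<^sub>F n in F. invertible_bop (U z n)"
    using eventually_invertible[OF _ z0, of G] by simp
  \<comment> \<open>A single index must serve both sequences.\<close>
  ultimately have "\<forall>\<^sub>F n in F. invertible_bop (L z n) \<and> invertible_bop (U z n)"
    by (rule eventually_conj)
  then obtain m where "invertible_bop (L z m)" "invertible_bop (U z m)"
    using eventually_happens'[OF F(1)] by blast
  with z show ?thesis
    by (intro exact_pair_of_invertible inv left_solution_L sol wronskian_self)
qed

end

section \<open>Continuation from the unit circle to the annulus\<close>

locale jost_solution_continued = jost_solution +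
  fixes \<epsilon> :: real
  assumes \<epsilon>: "\<epsilon> > 0" and hol: "holomorphic_extension \<epsilon> U"
begin

text \<open>Chosen to be open, connected, invariant under conjugation and inversion, and to contain
  the unit circle, so that identities between \<open>L z\<close>, \<open>U z\<close> and
  \<open>U (inverse z)\<close> can be continued from the circle.\<close>

definition annulus :: "complex set" where
  "annulus = {z. exp (- \<epsilon> / 2) < cmod z \<and> cmod z < exp (\<epsilon> / 2)}"

lemma open_annulus: "open annulus"
  unfolding annulus_def by (intro open_Collect_conj open_Collect_less continuous_intros)

lemma connected_annulus_set: "connected annulus"
  using connected_annulus(1)[of "exp (- \<epsilon> / 2)" "0::complex" "exp (\<epsilon> / 2)"]
  by (simp add: annulus_def)

lemma annulus_nonzero: "z \<in> annulus \<Longrightarrow> z \<noteq> 0"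
  by (auto simp: annulus_def)

lemma annulus_cnj: "z \<in> annulus \<Longrightarrow> cnj z \<in> annulus"
  by (simp add: annulus_def)

lemma annulus_inverse: "z \<in> annulus \<Longrightarrow> inverse z \<in> annulus"
  using less_imp_inverse_less[of "exp (- \<epsilon> / 2)" "cmod z"]
    less_imp_inverse_less[of "cmod z" "exp (\<epsilon> / 2)"]
  by (auto simp: annulus_def norm_inverse exp_minus annulus_nonzero)

lemma annulus_circle: "cmod z = 1 \<Longrightarrow> z \<in> annulus"
  using \<epsilon> by (simp add: annulus_def)

lemma continuation:
  fixes f :: "complex \<Rightarrow> 'a bop"
  assumes "norm_holomorphic_on f annulus" "\<And>z. cmod z = 1 \<Longrightarrow> f z = 0" "z \<in> annulus"
  shows "f z = 0"
  by (rule norm_holomorphic_continuation[OF assms(1) open_annulus connected_annulus_set])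
    (use assms annulus_circle in auto)

lemma holomorphic_U: "norm_holomorphic_on (\<lambda>z. U z n) annulus"
proof (rule norm_holomorphic_on_subset)
  show "norm_holomorphic_on (\<lambda>z. U z n) {z. 0 < cmod z \<and> cmod z < exp (\<epsilon> / 2)}"
    using hol by (simp add: holomorphic_extension_def)
  show "annulus \<subseteq> {z. 0 < cmod z \<and> cmod z < exp (\<epsilon> / 2)}"
    by (auto simp: annulus_def intro: less_trans[OF exp_gt_zero])
qed

lemma holomorphic_L: "norm_holomorphic_on (\<lambda>z. L z n) annulus"
  unfolding L_def using annulus_cnj
  by (intro norm_holomorphic_on_adj_cnj[OF holomorphic_U]) auto

lemma holomorphic_inverse: "inverse holomorphic_on annulus"
  by (intro holomorphic_intros) (use annulus_nonzero in auto)

lemma holomorphic_U_inverse: "norm_holomorphic_on (\<lambda>z. U (inverse z) n) annulus"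
  using annulus_inverse
  by (intro norm_holomorphic_on_compose[OF holomorphic_inverse holomorphic_U]) auto

text \<open>The defect in the recursion is holomorphic in \<open>z\<close> and vanishes on the unit
  circle, so the continued Jost solution still solves the equation outside the disc.\<close>

lemma sol_annulus:
  assumes z: "z \<in> annulus"
  shows "op_solution A B (z + inverse z) (U z)"
  unfolding op_solution_def
proof
  fix n
  define f where "f = (\<lambda>z. A (n - 1) * U z (n - 1) + B n * U z n + A n * U z (n + 1)
    - (z + inverse z) *\<^sub>C U z n)"
  have "f z = 0"
  proof (rule continuation[OF _ _ z])
    show "norm_holomorphic_on f annulus"
      unfolding f_def
      by (intro norm_holomorphic_on_diff norm_holomorphic_on_add norm_holomorphic_on_mult
        norm_holomorphic_on_const norm_holomorphic_on_scaleC holomorphic_U holomorphic_intros)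
        (use annulus_nonzero in auto)
    show "f w = 0" if "cmod w = 1" for w
      using sol[of w] that by (simp add: f_def op_solution_def)
  qed
  then show "A (n - 1) * U z (n - 1) + B n * U z n + A n * U z (n + 1) = (z + inverse z) *\<^sub>C U z n"
    by (simp add: f_def)
qed

lemma left_solution_annulus: "z \<in> annulus \<Longrightarrow> left_solution A B (z + inverse z) (L z)"
  by (intro left_solution_L_of sol_annulus annulus_cnj)

lemma sol_inverse_annulus:
  "z \<in> annulus \<Longrightarrow> op_solution A B (z + inverse z) (U (inverse z))"
  using sol_annulus[OF annulus_inverse, of z] by (simp add: add.commute)

lemma wronskian_self_annulus:
  assumes z: "z \<in> annulus"
  shows "wronskian_at A (L z) (U z) n = 0"
proof (rule continuation[OF _ _ z])
  show "norm_holomorphic_on (\<lambda>z. wronskian_at A (L z) (U z) n) annulus"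
    unfolding wronskian_at_def
    by (intro norm_holomorphic_on_diff norm_holomorphic_on_mult norm_holomorphic_on_const
      holomorphic_U holomorphic_L)
  show "wronskian_at A (L w) (U w) n = 0" if "cmod w = 1" for w
    using wronskian_self[of w] that by simp
qed

lemma wronskian_inverse_annulus:
  assumes z: "z \<in> annulus"
  shows "wronskian_at A (L z) (U (inverse z)) n = (z powi (- \<sigma>) - z powi \<sigma>) *\<^sub>C 1"
proof -
  have "wronskian_at A (L z) (U (inverse z)) n - (z powi (- \<sigma>) - z powi \<sigma>) *\<^sub>C 1 = 0"
  proof (rule continuation[OF _ _ z])
    show "norm_holomorphic_on
        (\<lambda>z. wronskian_at A (L z) (U (inverse z)) n - (z powi (- \<sigma>) - z powi \<sigma>) *\<^sub>C 1) annulus"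
      unfolding wronskian_at_def
      by (intro norm_holomorphic_on_diff norm_holomorphic_on_mult norm_holomorphic_on_const
        holomorphic_U_inverse holomorphic_L norm_holomorphic_on_scaleC holomorphic_intros)
        (use annulus_nonzero in auto)
  qed (simp add: wronskian_inverse)
  then show ?thesis by simp
qed

lemma exact_pair_annulus:
  assumes z: "z \<in> annulus"
  shows "exact_pair A B (z + inverse z) (L z) (U z)"
proof (cases "cmod z \<le> 1")
  case True
  then show ?thesis using exact_pair_inside annulus_nonzero[OF z] by simp
next
  case False
  have z0: "z \<noteq> 0" using annulus_nonzero[OF z] .
  \<comment> \<open>Equality would mean \<open>z * z = 1\<close>, impossible outside the closed unit
    disc.\<close>
  have ne: "z powi \<sigma> \<noteq> z powi (- \<sigma>)"
  proof
    assume "z powi \<sigma> = z powi (- \<sigma>)"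
    then have "z * z = 1" using \<sigma>(1) z0 by (auto simp: power_int_minus field_simps)
    then have "cmod z * cmod z = 1" by (metis norm_mult norm_one)
    moreover have "1 * 1 < cmod z * cmod z"
      using False by (intro mult_strict_mono) auto
    ultimately show False by simp
  qed
  \<comment> \<open>Inversion preserves the spectral parameter, so the exact pair at
    \<open>inverse z\<close> concerns the same equation as the one sought at
    \<open>z\<close>.\<close>
  have sum: "inverse z + inverse (inverse z) = z + inverse z" by (simp add: add.commute)
  have inside: "exact_pair A B (z + inverse z) (L (inverse z)) (U (inverse z))"
    using exact_pair_inside[of "inverse z", unfolded sum] False z0
    by (simp add: norm_inverse inverse_le_1_iff)
  then have left: "left_solution A B (z + inverse z) (L (inverse z))"
    by (simp add: exact_pair_def)
  show ?thesis
  proof (rule exact_pair_swap[OF inside])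
    \<comment> \<open>The Wronskian identity is used at \<open>inverse z\<close>, which exchanges
      the two powers; \<open>ne\<close> makes the resulting scalar nonzero.\<close>
    have "wronskian A (L (inverse z)) (U z)
        = wronskian_at A (L (inverse z)) (U (inverse (inverse z))) 0"
      unfolding wronskian_eq[OF left sol_annulus[OF z], of 0] by simp
    also have "\<dots> = (z powi \<sigma> - z powi (- \<sigma>)) *\<^sub>C 1"
      unfolding wronskian_inverse_annulus[OF annulus_inverse[OF z]]
      by (simp add: power_int_inverse power_int_minus)
    finally show "invertible_bop (wronskian A (L (inverse z)) (U z))"
      using ne by (simp add: invertible_bop_scaleC)
    show "invertible_bop (wronskian A (L z) (U (inverse z)))"
      unfolding wronskian_eq[OF left_solution_annulus[OF z] sol_inverse_annulus[OF z], of 0]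
        wronskian_inverse_annulus[OF z]
      using ne by (simp add: invertible_bop_scaleC)
  qed (rule left_solution_annulus[OF z] sol_annulus[OF z] wronskian_self_annulus[OF z])+
qed

end

section \<open>Limits of the coefficients from the moment conditions\<close>

lemma tendsto_zero_of_summable_on_int:
  fixes f g :: "int \<Rightarrow> real"
  assumes f: "f summable_on UNIV" and g: "\<And>n. 0 \<le> g n" "\<And>n. n \<noteq> 0 \<Longrightarrow> g n \<le> f n"
  shows "(g \<longlongrightarrow> 0) at_top" "(g \<longlongrightarrow> 0) at_bot"
proof -
  have *: "(h \<longlongrightarrow> 0) at_top"
    if f: "f summable_on UNIV" and h: "\<And>n. 0 \<le> h n" "\<And>n. n \<noteq> 0 \<Longrightarrow> h n \<le> f n" for f h :: "int \<Rightarrow> real"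
  proof (rule Lim_null_comparison)
    have "f summable_on range int"
      by (rule summable_on_subset[OF f]) simp
    then have "(\<lambda>k. f (int k)) summable_on UNIV"
      using summable_on_reindex[of int UNIV f] by (simp add: o_def)
    then have "(\<lambda>k. f (int k)) \<longlonglongrightarrow> 0"
      by (intro summable_LIMSEQ_zero summable_on_imp_summable)
    then show "((\<lambda>n. f (int (nat n))) \<longlongrightarrow> 0) at_top"
      by (rule filterlim_compose) (rule filterlim_nat_sequentially)
    show "\<forall>\<^sub>F n in at_top. norm (h n) \<le> f (int (nat n))"
      using eventually_ge_at_top[of 1] by eventually_elim (use h in simp)
  qed
  show "(g \<longlongrightarrow> 0) at_top" by (rule *[OF f g])
  \<comment> \<open>Reflecting the index turns the limit along \<open>at_bot\<close> into one along
    \<open>at_top\<close>.\<close>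
  have "(\<lambda>n. f (- n)) summable_on UNIV"
    using summable_on_reindex[of uminus UNIV f] f by (simp add: o_def)
  then have "((\<lambda>n. g (- n)) \<longlongrightarrow> 0) at_top"
    by (rule *) (use g in auto)
  then show "(g \<longlongrightarrow> 0) at_bot"
    by (simp add: at_bot_mirror filterlim_filtermap)
qed

text \<open>Both weights are at least 1 away from \<open>n = 0\<close>, so the summands dominate
  \<open>norm (A n - 1)\<close> there and tend to zero. The index 0 is excluded because the weight
  of the first moment vanishes at it.\<close>

lemma moment_imp_tendsto:
  assumes "first_moment A B \<or> (\<exists>\<epsilon>>0. exp_moment \<epsilon> A B)"
  shows "(A \<longlongrightarrow> 1) at_top" "(A \<longlongrightarrow> 1) at_bot"
proof -
  have "\<exists>w. (\<lambda>n. w n * (norm (1 - A n) + norm (B n))) summable_on UNIV \<and>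
      (\<forall>n. n \<noteq> 0 \<longrightarrow> (1::real) \<le> w n)"
    using assms
  proof
    assume "first_moment A B"
    then show ?thesis unfolding first_moment_def
      by (intro exI[of _ "\<lambda>n. real_of_int \<bar>n\<bar>"]) auto
  next
    assume "\<exists>\<epsilon>>0. exp_moment \<epsilon> A B"
    then obtain \<epsilon> where "\<epsilon> > 0" "exp_moment \<epsilon> A B" by blast
    then show ?thesis unfolding exp_moment_def
      by (intro exI[of _ "\<lambda>n. exp (\<epsilon> * real_of_int \<bar>n\<bar>)"]) auto
  qed
  then obtain w where w: "(\<lambda>n. w n * (norm (1 - A n) + norm (B n))) summable_on UNIV"
    "\<And>n. n \<noteq> 0 \<Longrightarrow> (1::real) \<le> w n" by blast
  have "norm (A n - 1) \<le> w n * (norm (1 - A n) + norm (B n))" if "n \<noteq> 0" for n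
    using mult_mono[OF w(2)[OF that], of "norm (A n - 1)" "norm (1 - A n) + norm (B n)"]
      w(2)[OF that] by (simp add: norm_minus_commute)
  from tendsto_zero_of_summable_on_int[OF w(1) _ this]
  show "(A \<longlongrightarrow> 1) at_top" "(A \<longlongrightarrow> 1) at_bot"
    by (simp_all add: LIM_zero_iff tendsto_norm_zero_iff)
qed

lemma jost_plus_imp_jost_solution:
  assumes "\<And>n. selfadjoint (A n)" "\<And>n. selfadjoint (B n)" "\<And>n. invertible_bop (A n)"
    and "(A \<longlongrightarrow> 1) at_top" "jost_plus A B U"
  shows "jost_solution A B at_top 1 U"
proof
  show "filterlim (\<lambda>n::int. n - 1) at_top at_top"
    unfolding filterlim_at_top eventually_at_top_linorder
  proof
    show "\<exists>N. \<forall>n\<ge>N. Z \<le> n - 1" for Z :: int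
      by (rule exI[of _ "Z + 1"]) auto
  qed
qed (use assms in \<open>auto simp: jost_plus_def eventually_ge_at_top\<close>)

lemma jost_minus_imp_jost_solution:
  assumes "\<And>n. selfadjoint (A n)" "\<And>n. selfadjoint (B n)" "\<And>n. invertible_bop (A n)"
    and "(A \<longlongrightarrow> 1) at_bot" "jost_minus A B U"
  shows "jost_solution A B at_bot (- 1) U"
proof
  show "filterlim (\<lambda>n::int. n - 1) at_bot at_bot"
    unfolding filterlim_at_bot eventually_at_bot_linorder
  proof
    show "\<exists>N. \<forall>n\<le>N. n - 1 \<le> Z" for Z :: int
      by (rule exI[of _ Z]) auto
  qed
  show "\<forall>\<^sub>F n in at_bot. - 1 * n \<ge> (1::int)"
    using eventually_le_at_bot[of "- 1"] by eventually_elim simp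
qed (use assms in \<open>auto simp: jost_minus_def\<close>)

theorem theorem1p3:
  fixes A B :: "int \<Rightarrow> 'h::separable_hilbert_space bop"
    and Up Um :: "complex \<Rightarrow> int \<Rightarrow> 'h bop"
  assumes "\<And>n. selfadjoint (A n)" and "\<And>n. selfadjoint (B n)"
    and "\<And>n. invertible_bop (A n)"
    and "jost_plus A B Up" and "jost_minus A B Um"
  shows "(\<forall>z R S.
      (first_moment A B \<and> cmod z = 1 \<or>
        (\<exists>\<epsilon>>0. exp_moment \<epsilon> A B \<and> holomorphic_extension \<epsilon> Up \<and> holomorphic_extension \<epsilon> Um \<and>
          exp (- \<epsilon> / 2) < cmod z \<and> cmod z < exp (\<epsilon> / 2))) \<and>
      (R, S) \<in> {(Up, \<lambda>w. Up (inverse w)), (Um, \<lambda>w. Um (inverse w)),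
                (Up, \<lambda>w. Um (inverse w)), (Um, \<lambda>w. Up (inverse w)),
                (Up, Um), (Um, Up)} \<and>
      invertible_bop (wronskian A (\<lambda>n. adj (R (cnj z) n)) (S z))
      \<longrightarrow> fundamental_system A B (z + inverse z) (R z) (S z)) \<and>
    (\<forall>z R S.
      first_moment A B \<and> 0 < cmod z \<and> cmod z \<le> 1 \<and>
      (finite_dim_space TYPE('h) \<or> (\<forall>n. compact_bop (B n) \<and> compact_bop (A n - 1))) \<and>
      (R, S) \<in> {(Up, Um), (Um, Up)} \<and>
      invertible_bop (wronskian A (\<lambda>n. adj (R (cnj z) n)) (S z))
      \<longrightarrow> fundamental_system A B (z + inverse z) (R z) (S z))"
proof -
  \<comment> \<open>Hiding \<open>F\<close> and \<sigma> behind existential quantifiers lets one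
    argument treat the Jost solutions at both ends.\<close>
  have jost: "\<exists>F \<sigma>. jost_solution A B F \<sigma> U"
    if "first_moment A B \<or> (\<exists>\<epsilon>>0. exp_moment \<epsilon> A B)" "U = Up \<or> U = Um" for U
    using jost_plus_imp_jost_solution[OF assms(1-3) _ assms(4)]
      jost_minus_imp_jost_solution[OF assms(1-3) _ assms(5)] moment_imp_tendsto[OF that(1)] that(2)
    by blast
  show ?thesis
  proof (rule conjI; intro allI impI; elim conjE)
    fix z R S
    assume dom: "first_moment A B \<and> cmod z = 1 \<or>
        (\<exists>\<epsilon>>0. exp_moment \<epsilon> A B \<and> holomorphic_extension \<epsilon> Up \<and> holomorphic_extension \<epsilon> Um \<and>
          exp (- \<epsilon> / 2) < cmod z \<and> cmod z < exp (\<epsilon> / 2))"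
      and RS: "(R, S) \<in> {(Up, \<lambda>w. Up (inverse w)), (Um, \<lambda>w. Um (inverse w)),
                  (Up, \<lambda>w. Um (inverse w)), (Um, \<lambda>w. Up (inverse w)), (Up, Um), (Um, Up)}"
      and W: "invertible_bop (wronskian A (\<lambda>n. adj (R (cnj z) n)) (S z))"
    \<comment> \<open>In all six pairs \<open>R\<close> is a Jost solution itself and
      \<open>S\<close> is a Jost solution taken at \<open>z\<close> or at \<open>inverse z\<close>,
      so three facts about a single \<open>U\<close> cover every pair.\<close>
    have facts: "exact_pair A B (z + inverse z) (\<lambda>n. adj (U (cnj z) n)) (U z) \<and>
        op_solution A B (z + inverse z) (U z) \<and> op_solution A B (z + inverse z) (U (inverse z))"
      if U: "U = Up \<or> U = Um" for U
    proof -
      obtain F \<sigma> where "jost_solution A B F \<sigma> U"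
        using jost[OF _ U] dom by blast
      then interpret jost_solution A B F \<sigma> U .
      have L: "L z = (\<lambda>n. adj (U (cnj z) n))" by (simp add: L_def fun_eq_iff)
      from dom show ?thesis
      proof (elim disjE exE conjE)
        assume "cmod z = 1"
        then show ?thesis
          using exact_pair_inside[of z] sol[of z] sol_inverse[of z] by (simp add: L)
      next
        fix \<epsilon> :: real
        assume \<epsilon>: "\<epsilon> > 0" "holomorphic_extension \<epsilon> Up" "holomorphic_extension \<epsilon> Um"
          and z: "exp (- \<epsilon> / 2) < cmod z" "cmod z < exp (\<epsilon> / 2)"
        interpret jost_solution_continued A B F \<sigma> U \<epsilon>
          by unfold_locales (use \<epsilon> U in auto)
        have z: "z \<in> annulus" using z by (simp add: annulus_def)
        show ?thesis
          using exact_pair_annulus[OF z] sol_annulus[OF z] sol_inverse_annulus[OF z] by (simp add: L)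
      qed
    qed
    have "exact_pair A B (z + inverse z) (\<lambda>n. adj (R (cnj z) n)) (R z)"
      using RS facts[of Up] facts[of Um] by auto
    moreover have "op_solution A B (z + inverse z) (S z)"
      using RS facts[of Up] facts[of Um] by auto
    ultimately show "fundamental_system A B (z + inverse z) (R z) (S z)"
      using W by (rule fundamental_systemI)
  next
    fix z R S
    assume fm: "first_moment A B" and z: "0 < cmod z" "cmod z \<le> 1"
      and RS: "(R, S) \<in> {(Up, Um), (Um, Up)}"
      and W: "invertible_bop (wronskian A (\<lambda>n. adj (R (cnj z) n)) (S z))"
    \<comment> \<open>Both members of these pairs are taken at \<open>z\<close>, so everything
      happens inside the closed punctured disc.\<close>
    have facts: "exact_pair A B (z + inverse z) (\<lambda>n. adj (U (cnj z) n)) (U z) \<and>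
        op_solution A B (z + inverse z) (U z)" if U: "U = Up \<or> U = Um" for U
    proof -
      obtain F \<sigma> where "jost_solution A B F \<sigma> U"
        using jost[OF _ U] fm by blast
      then interpret jost_solution A B F \<sigma> U .
      have L: "L z = (\<lambda>n. adj (U (cnj z) n))" by (simp add: L_def fun_eq_iff)
      show ?thesis using exact_pair_inside[OF z] sol[OF z] by (simp add: L)
    qed
    have "exact_pair A B (z + inverse z) (\<lambda>n. adj (R (cnj z) n)) (R z)"
      using RS facts[of Up] facts[of Um] by auto
    moreover have "op_solution A B (z + inverse z) (S z)"
      using RS facts[of Up] facts[of Um] by auto
    ultimately show "fundamental_system A B (z + inverse z) (R z) (S z)"
      using W by (rule fundamental_systemI)
  qed
qed

end
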